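(* For the quantum metric $g=g_{+-}+g_{-+}$ on the quantum projective space of dimension $r$ and the inverse metric $(\cdot,\cdot):\Omega\otimes_{\mathcal{B}}\Omega\to\mathcal{B}$ we have $$(\cdot,\cdot)(g_{+-})=q^{-(\omega_s,2\rho)}\,\mathrm{qdim}(V)-1,\qquad(\cdot,\cdot)(g_{-+})=q^{(\omega_s,2\rho)}\,\mathrm{qdim}(V)-1.$$ Moreover the quantum metric dimension can be written as $$(\cdot,\cdot)(g)=(q^{r+1}+q^{-(r+1)})\,[r]_q.$$
   Context: **Quantum group data.** Fix an integer $r\ge 1$, a real number $0<q<1$ and $s\in\{1,r\}$. $U_q(\mathfrak{sl}_{r+1})$ is the quantized enveloping algebra with generators $K_i^{\pm1},E_i,F_i$, $1\le i\le r$ (Klimyk–Schmüdgen conventions: $\Delta(K_i)=K_i\otimes K_i$, $\Delta(E_i)=E_i\otimes K_i+1\otimes E_i$, $\Delta(F_i)=F_i\otimes 1+K_i^{-1}\otimes F_i$; $K_i$ acts on a vector of weight $\mu$ by $q^{(\alpha_i,\mu)}$). Here $\alpha_i$ are the simple roots, $\omega_i$ the fundamental weights, $\rho=\sum_i\omega_i$, $w_0$ the longest Weyl group element, $(\cdot,\cdot)$ on weights is the invariant form with $(\alpha_i,\alpha_i)=2$. Put $a=(\alpha_s,\alpha_s)=2$, $w=(\omega_s,\omega_s)$, $m=(\omega_s,2\rho)=r$. $V(\lambda)$ is the simple type 1 module of highest weight $\lambda$, $V=V(\omega_s)$, and $V^*$ is its dual with $(Xf)(v)=f(S(X)v)$,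 $S$ the antipode. $\hat{R}_{X,Y}:X\otimes Y\to Y\otimes X$ is the braiding on finite-dimensional type 1 modules determined by being a module map with $\hat{R}_{V(\lambda),V(\mu)}(v\otimes u)=q^{(\lambda,w_0\mu)}u\otimes v$ for $v$ a highest weight vector of $V(\lambda)$ and $u$ a lowest weight vector of $V(\mu)$. Let $(v_i)$ be a weight basis of $V$ with weights $\lambda_i$ and dual basis $(f^i)$ of $V^*$. Define $\mathsf{E}(f^i\otimes v_j)=\delta_{ij}$, $\mathsf{E}'(v_i\otimes f^j)=q^{(\lambda_i,2\rho)}\delta_{ij}$, $\mathsf{C}=\sum_i v_i\otimes f^i$, $\mathsf{C}'=\sum_i q^{-(\lambda_i,2\rho)}f^i\otimes v_i$. Also $\mathrm{qdim}(V)=\sum_i q^{(\lambda_i,2\rho)}$ and $[x]_q=\frac{q^x-q^{-x}}{q-q^{-1}}$. Subscripts indicate the tensor legs on which a map acts ($\mathsf{C}_n,\mathsf{C}'_n$ insert the element at legs $n,n+1$); products of maps are compositions (rightmost first), legs being renumbered after each contraction or insertion. Put $$\mathsf{S}_{123}=(\hat{R}_{V,V^*})_{23}(\hat{R}_{V,V})_{12}(\hat{R}_{V,V^*}^{-1})_{23},\quad \tilde{\mathsf{S}}_{234}=(\hat{R}_{V,V^*})_{23}(\hat{R}_{V^*,V^*}^{-1})_{34}(\hat{R}_{V,V^*}^{-1})_{23},\quad \mathsf{T}_{1234}=\mathsf{S}_{123}\tilde{\mathsf{S}}_{234}=\tilde{\mathsf{S}}_{234}\mathsf{S}_{123}$$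 (acting on $V\otimes V^*\otimes V$, $V^*\otimes V\otimes V^*$, $V\otimes V^*\otimes V\otimes V^*$ at the indicated legs). **Index-free notation.** A family $x=(x^{ij})_{1\le i,j\le r+1}$ is identified with $\sum_{i,j}v_i\otimes f^j\otimes x^{ij}$; products of families $xy$ (also $x\otimes y$, $(x,y)$) denote $\sum v_i\otimes f^j\otimes v_k\otimes f^l\otimes x^{ij}y^{kl}$ (resp. with $\otimes_{\mathcal{B}}$, the inverse metric), and similarly for more factors. The maps above act on the $V,V^*$ legs; other maps act on components. **Algebra and first-order calculus.** $\mathcal{B}$ is the unital algebra generated by $p^{ij}$, $1\le i,j\le r+1$, with relations $\mathsf{S}_{123}pp=q^{w}pp$, $\tilde{\mathsf{S}}_{234}pp=q^{-w}pp$, $\mathsf{E}'_{12}p=q^{m}$. The Heckenberger–Kolb first-order differential calculus is $\Omega=\Omega_+\oplus\Omega_-$, with $\Omega_+,\Omega_-$ generated as left $\mathcal{B}$-modules by $\partial p^{ij}$, resp. $\bar\partial p^{ij}$, with relations $$\tilde{\mathsf{S}}_{234}p\,\partial p=q^{-w}p\,\partial p,\quad \mathsf{E}'_{12}\partial p=0,\qquad \mathsf{S}_{123}p\,\bar\partial p=q^{w}p\,\bar\partial p,\quad \mathsf{E}'_{12}\bar\partial p=0,$$ and right module structure $\partial p\,p=q^{a}\mathsf{T}_{1234}p\,\partial p$, $\bar\partial p\,p=q^{-a}\mathsf{T}_{1234}p\,\bar\partial p$. **Metric and inverse metric.** $g=g_{+-}+g_{-+}$ with $g_{+-}=\mathsf{E}'_{12}\mathsf{E}_{23}\,\partial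 p\otimes\bar\partial p$ and $g_{-+}=\mathsf{E}'_{12}\mathsf{E}_{23}\,\bar\partial p\otimes\partial p$ in $\Omega\otimes_{\mathcal{B}}\Omega$. The inverse metric is the (well-defined) $\mathcal{B}$-bimodule map $(\cdot,\cdot):\Omega\otimes_{\mathcal{B}}\Omega\to\mathcal{B}$ with $(\partial p,\partial p)=(\bar\partial p,\bar\partial p)=0$, $(\partial p,\bar\partial p)=q^{a}q^{-w-m}\mathsf{S}_{123}\mathsf{C}_3p-q^{a}q^{-m}pp$, $(\bar\partial p,\partial p)=\mathsf{C}'_2p-q^{-m}pp$. The quantum metric dimension is the element $(\cdot,\cdot)(g)\in\mathcal{B}$. *)

theory Defs
  imports "HOL-Analysis.Analysis" "HOL-Library.Poly_Mapping"
begin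

section \<open>Weights of type $A_r$\<close>

text \<open>
  Weights are written in the coordinates $1,\dots,r+1$ of the standard realisation of the root
  system $A_r$ in the trace-zero hyperplane of $\mathbb{R}^{r+1}$ (all other coordinates are 0).
  The dot product is then the invariant form with $(\alpha_i,\alpha_i)=2$, and the Weyl group is
  the symmetric group permuting the coordinates, whose longest element reverses them.
\<close>

type_synonym weight = "nat \<Rightarrow> real"

definition simple_root :: "nat \<Rightarrow> weight" where
  "simple_root i = (\<lambda>k. if k = i then 1 else if k = i + 1 then -1 else 0)"

definition fund_weight :: "nat \<Rightarrow> nat \<Rightarrow> weight" where
  "fund_weight r i = (\<lambda>k. if k \<in> {1..r+1}
     then (if k \<le> i then 1 else 0) - real i / real (r + 1) else 0)"

definition weight_form :: "nat \<Rightarrow> weight \<Rightarrow> weight \<Rightarrow> real" where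
  "weight_form r x y = (\<Sum>k=1..r+1. x k * y k)"

definition two_rho :: "nat \<Rightarrow> weight" where
  "two_rho r = (\<lambda>k. 2 * (\<Sum>i=1..r. fund_weight r i k))"

definition longest :: "nat \<Rightarrow> weight \<Rightarrow> weight" where
  "longest r x = (\<lambda>k. if k \<in> {1..r+1} then x (r + 2 - k) else 0)"

definition weight_lattice :: "nat \<Rightarrow> weight set" where
  "weight_lattice r = {x. \<exists>n :: nat \<Rightarrow> int. x = (\<lambda>k. \<Sum>i=1..r. of_int (n i) * fund_weight r i k)}"

definition w_const :: "nat \<Rightarrow> nat \<Rightarrow> real" where
  "w_const r s = weight_form r (fund_weight r s) (fund_weight r s)"

definition m_const :: "nat \<Rightarrow> nat \<Rightarrow> real" where
  "m_const r s = weight_form r (fund_weight r s) (two_rho r)"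

definition a_const :: "nat \<Rightarrow> nat \<Rightarrow> real" where
  "a_const r s = weight_form r (simple_root s) (simple_root s)"

definition q_pow :: "real \<Rightarrow> real \<Rightarrow> complex" where
  "q_pow q x = complex_of_real (q powr x)"

definition q_num :: "real \<Rightarrow> real \<Rightarrow> real" where
  "q_num q x = (q powr x - q powr (-x)) / (q - inverse q)"


section \<open>Finite-dimensional modules over the quantized enveloping algebra\<close>

text \<open>
  A finite-dimensional module with a chosen basis indexed by a finite type is given by the matrices
  of the generators $K_i$, $K_i^{-1}$, $E_i$, $F_i$ for $1\le i\le r$, subject to the defining
  relations of $U_q(\mathfrak{sl}_{r+1})$.  The values at other indices are irrelevant.
\<close>

record 'n uq_rep =
  actK :: "nat \<Rightarrow> complex^'n^'n"
  actKi :: "nat \<Rightarrow> complex^'n^'n"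
  actE :: "nat \<Rightarrow> complex^'n^'n"
  actF :: "nat \<Rightarrow> complex^'n^'n"

definition q_serre :: "nat \<Rightarrow> real \<Rightarrow> (nat \<Rightarrow> complex^'n^'n) \<Rightarrow> bool" where
  "q_serre r q X \<longleftrightarrow> (\<forall>i\<in>{1..r}. \<forall>j\<in>{1..r}.
     ((i = j + 1 \<or> j = i + 1) \<longrightarrow>
        X i ** X i ** X j - (q + inverse q) *\<^sub>R (X i ** X j ** X i) + X j ** X i ** X i = 0) \<and>
     (i \<noteq> j \<and> i \<noteq> j + 1 \<and> j \<noteq> i + 1 \<longrightarrow> X i ** X j = X j ** X i))"

definition is_uq_module :: "nat \<Rightarrow> real \<Rightarrow> ('n::finite) uq_rep \<Rightarrow> bool" where
  "is_uq_module r q M \<longleftrightarrow>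
     (\<forall>i\<in>{1..r}. actK M i ** actKi M i = mat 1 \<and> actKi M i ** actK M i = mat 1) \<and>
     (\<forall>i\<in>{1..r}. \<forall>j\<in>{1..r}.
        actK M i ** actK M j = actK M j ** actK M i \<and>
        actK M i ** actE M j ** actKi M i =
          (q powr weight_form r (simple_root i) (simple_root j)) *\<^sub>R actE M j \<and>
        actK M i ** actF M j ** actKi M i =
          (q powr (- weight_form r (simple_root i) (simple_root j))) *\<^sub>R actF M j \<and>
        actE M i ** actF M j - actF M j ** actE M i =
          (if i = j then inverse (q - inverse q) *\<^sub>R (actK M i - actKi M i) else 0)) \<and>
     q_serre r q (actE M) \<and> q_serre r q (actF M)"

definition has_weight :: "nat \<Rightarrow> real \<Rightarrow> ('n::finite) uq_rep \<Rightarrow> weight \<Rightarrow> complex^'n \<Rightarrow> bool" where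
  "has_weight r q M mu v \<longleftrightarrow>
     (\<forall>i\<in>{1..r}. actK M i *v v = (q powr weight_form r (simple_root i) mu) *\<^sub>R v)"

definition highest_weight_vector ::
    "nat \<Rightarrow> real \<Rightarrow> ('n::finite) uq_rep \<Rightarrow> weight \<Rightarrow> complex^'n \<Rightarrow> bool" where
  "highest_weight_vector r q M mu v \<longleftrightarrow>
     v \<noteq> 0 \<and> has_weight r q M mu v \<and> (\<forall>i\<in>{1..r}. actE M i *v v = 0)"

definition lowest_weight_vector ::
    "nat \<Rightarrow> real \<Rightarrow> ('n::finite) uq_rep \<Rightarrow> weight \<Rightarrow> complex^'n \<Rightarrow> bool" where
  "lowest_weight_vector r q M mu v \<longleftrightarrow>
     v \<noteq> 0 \<and> has_weight r q M mu v \<and> (\<forall>i\<in>{1..r}. actF M i *v v = 0)"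

definition uq_submodule :: "nat \<Rightarrow> ('n::finite) uq_rep \<Rightarrow> (complex^'n) set \<Rightarrow> bool" where
  "uq_submodule r M W \<longleftrightarrow> vec.subspace W \<and>
     (\<forall>i\<in>{1..r}. \<forall>v\<in>W. actK M i *v v \<in> W \<and> actKi M i *v v \<in> W \<and>
        actE M i *v v \<in> W \<and> actF M i *v v \<in> W)"

text \<open>\<open>is_simple_module r q M mu\<close>: \<open>M\<close> is (a copy of) the simple type 1 module $V(\mu)$.\<close>

definition is_simple_module :: "nat \<Rightarrow> real \<Rightarrow> ('n::finite) uq_rep \<Rightarrow> weight \<Rightarrow> bool" where
  "is_simple_module r q M mu \<longleftrightarrow>
     is_uq_module r q M \<and> mu \<in> weight_lattice r \<and>
     (\<forall>W. uq_submodule r M W \<longrightarrow> W = {0} \<or> W = UNIV) \<and>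
     (\<exists>v. highest_weight_vector r q M mu v)"

definition is_weight_basis ::
    "nat \<Rightarrow> real \<Rightarrow> ('n::finite) uq_rep \<Rightarrow> ('n \<Rightarrow> weight) \<Rightarrow> bool" where
  "is_weight_basis r q M wt \<longleftrightarrow>
     (\<forall>a. wt a \<in> weight_lattice r \<and> has_weight r q M (wt a) (axis a 1))"

definition kron :: "complex^'x^'x \<Rightarrow> complex^'y^'y \<Rightarrow> complex^('x \<times> 'y)^('x \<times> 'y)" where
  "kron A B = (\<chi> a b. A $ fst a $ fst b * B $ snd a $ snd b)"

definition vec_tensor :: "complex^'x \<Rightarrow> complex^'y \<Rightarrow> complex^('x \<times> 'y)" where
  "vec_tensor v u = (\<chi> a. v $ fst a * u $ snd a)"

text \<open>
  Coproduct $\Delta(K_i)=K_i\otimes K_i$, $\Delta(E_i)=E_i\otimes K_i+1\otimes E_i$,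
  $\Delta(F_i)=F_i\otimes 1+K_i^{-1}\otimes F_i$.
\<close>

definition tensor_rep :: "('x::finite) uq_rep \<Rightarrow> ('y::finite) uq_rep \<Rightarrow> ('x \<times> 'y) uq_rep" where
  "tensor_rep X Y = \<lparr>
     actK = (\<lambda>i. kron (actK X i) (actK Y i)),
     actKi = (\<lambda>i. kron (actKi X i) (actKi Y i)),
     actE = (\<lambda>i. kron (actE X i) (actK Y i) + kron (mat 1) (actE Y i)),
     actF = (\<lambda>i. kron (actF X i) (mat 1) + kron (actKi X i) (actF Y i)) \<rparr>"

text \<open>
  The dual module in the dual basis: the matrix of $X$ is the transpose of that of $S(X)$.  The
  coproduct above has antipode $S(K_i)=K_i^{-1}$, $S(E_i)=-E_iK_i^{-1}$, $S(F_i)=-K_iF_i$.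
\<close>

definition dual_rep :: "('n::finite) uq_rep \<Rightarrow> 'n uq_rep" where
  "dual_rep M = \<lparr>
     actK = (\<lambda>i. transpose (actKi M i)),
     actKi = (\<lambda>i. transpose (actK M i)),
     actE = (\<lambda>i. transpose (- (actE M i ** actKi M i))),
     actF = (\<lambda>i. transpose (- (actK M i ** actF M i))) \<rparr>"

definition intertwines ::
    "nat \<Rightarrow> ('x::finite) uq_rep \<Rightarrow> ('y::finite) uq_rep \<Rightarrow> complex^'x^'y \<Rightarrow> bool" where
  "intertwines r M N R \<longleftrightarrow> (\<forall>i\<in>{1..r}.
     R ** actK M i = actK N i ** R \<and> R ** actKi M i = actKi N i ** R \<and>
     R ** actE M i = actE N i ** R \<and> R ** actF M i = actF N i ** R)"

text \<open>
  The braiding $X\otimes Y\to Y\otimes X$ for simple type 1 modules $X=V(\lambda)$, $Y=V(\mu)$.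
  Since $X\otimes Y$ is generated by $v\otimes u$, the conditions determine the map uniquely.  The
  definition is meant for simple \<open>X\<close> and \<open>Y\<close> only.
\<close>

definition is_braiding :: "nat \<Rightarrow> real \<Rightarrow> ('x::finite) uq_rep \<Rightarrow> ('y::finite) uq_rep \<Rightarrow>
    complex^('x \<times> 'y)^('y \<times> 'x) \<Rightarrow> bool" where
  "is_braiding r q X Y R \<longleftrightarrow>
     invertible R \<and> intertwines r (tensor_rep X Y) (tensor_rep Y X) R \<and>
     (\<forall>la mu v u. is_simple_module r q X la \<and> is_simple_module r q Y mu \<and>
        highest_weight_vector r q X la v \<and> lowest_weight_vector r q Y (longest r mu) u \<longrightarrow>
        R *v vec_tensor v u = (q powr weight_form r la (longest r mu)) *\<^sub>R vec_tensor u v)"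

definition qdim :: "nat \<Rightarrow> real \<Rightarrow> ('n::finite \<Rightarrow> weight) \<Rightarrow> real" where
  "qdim r q wt = (\<Sum>a\<in>UNIV. q powr weight_form r (wt a) (two_rho r))"


section \<open>Index-free notation\<close>

text \<open>
  An element of a tensor product of copies of $V$ and $V^*$ with some vector space (with scalar
  multiplication \<open>sc\<close>) is the family of its coefficients, indexed by lists of basis indices, one
  entry for each leg.  Legs are counted from 1, list positions from 0.  Only the values on lists
  of the right length are meaningful.
\<close>

definition tensor_eq :: "nat \<Rightarrow> ('n list \<Rightarrow> 'm) \<Rightarrow> ('n list \<Rightarrow> 'm) \<Rightarrow> bool" where
  "tensor_eq N x y \<longleftrightarrow> (\<forall>ls. length ls = N \<longrightarrow> x ls = y ls)"

definition components :: "nat \<Rightarrow> ('n list \<Rightarrow> 'm) \<Rightarrow> 'm set" where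
  "components N x = {x ls | ls. length ls = N}"

definition family :: "('n \<Rightarrow> 'n \<Rightarrow> 'm) \<Rightarrow> 'n list \<Rightarrow> 'm" where
  "family x ls = x (ls ! 0) (ls ! 1)"

definition family_prod ::
    "('k \<Rightarrow> 'l \<Rightarrow> 'm) \<Rightarrow> ('n \<Rightarrow> 'n \<Rightarrow> 'k) \<Rightarrow> ('n \<Rightarrow> 'n \<Rightarrow> 'l) \<Rightarrow> 'n list \<Rightarrow> 'm" where
  "family_prod f x y ls = f (x (ls ! 0) (ls ! 1)) (y (ls ! 2) (ls ! 3))"

definition leg_apply :: "(complex \<Rightarrow> 'm \<Rightarrow> 'm) \<Rightarrow> nat \<Rightarrow> complex^('n \<times> 'n)^('n \<times> 'n) \<Rightarrow>
    (('n::finite) list \<Rightarrow> 'm::ab_group_add) \<Rightarrow> 'n list \<Rightarrow> 'm" where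
  "leg_apply sc n R x ls =
     (\<Sum>(a, b)\<in>UNIV. sc (R $ (ls ! (n - 1), ls ! n) $ (a, b)) (x (ls[n - 1 := a, n := b])))"

definition leg_contract :: "(complex \<Rightarrow> 'm \<Rightarrow> 'm) \<Rightarrow> nat \<Rightarrow> ('n \<Rightarrow> 'n \<Rightarrow> complex) \<Rightarrow>
    (('n::finite) list \<Rightarrow> 'm::ab_group_add) \<Rightarrow> 'n list \<Rightarrow> 'm" where
  "leg_contract sc n e x ls =
     (\<Sum>(a, b)\<in>UNIV. sc (e a b) (x (take (n - 1) ls @ [a, b] @ drop (n - 1) ls)))"

definition leg_insert :: "(complex \<Rightarrow> 'm \<Rightarrow> 'm) \<Rightarrow> nat \<Rightarrow> ('n \<Rightarrow> 'n \<Rightarrow> complex) \<Rightarrow>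
    ('n list \<Rightarrow> 'm) \<Rightarrow> 'n list \<Rightarrow> 'm" where
  "leg_insert sc n c x ls = sc (c (ls ! (n - 1)) (ls ! n)) (x (take (n - 1) ls @ drop (n + 1) ls))"

definition ev :: "'n \<Rightarrow> 'n \<Rightarrow> complex" where
  "ev a b = (if a = b then 1 else 0)"

definition ev' :: "nat \<Rightarrow> real \<Rightarrow> ('n \<Rightarrow> weight) \<Rightarrow> 'n \<Rightarrow> 'n \<Rightarrow> complex" where
  "ev' r q wt a b = (if a = b then q_pow q (weight_form r (wt a) (two_rho r)) else 0)"

definition coev :: "'n \<Rightarrow> 'n \<Rightarrow> complex" where
  "coev a b = (if a = b then 1 else 0)"

definition coev' :: "nat \<Rightarrow> real \<Rightarrow> ('n \<Rightarrow> weight) \<Rightarrow> 'n \<Rightarrow> 'n \<Rightarrow> complex" where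
  "coev' r q wt a b = (if a = b then q_pow q (- weight_form r (wt a) (two_rho r)) else 0)"

text \<open>
  The maps $\mathsf{S}_{123}$, $\tilde{\mathsf{S}}_{234}$, $\mathsf{T}_{1234}$ for given braidings
  \<open>RVV\<close>, \<open>RVD\<close>, \<open>RDD\<close> of $(V,V)$, $(V,V^*)$, $(V^*,V^*)$.
\<close>

definition S123 :: "(complex \<Rightarrow> 'm \<Rightarrow> 'm) \<Rightarrow> complex^('n \<times> 'n)^('n \<times> 'n) \<Rightarrow>
    complex^('n \<times> 'n)^('n \<times> 'n) \<Rightarrow> (('n::finite) list \<Rightarrow> 'm::ab_group_add) \<Rightarrow> 'n list \<Rightarrow> 'm" where
  "S123 sc RVV RVD x =
     leg_apply sc 2 RVD (leg_apply sc 1 RVV (leg_apply sc 2 (matrix_inv RVD) x))"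

definition St234 :: "(complex \<Rightarrow> 'm \<Rightarrow> 'm) \<Rightarrow> complex^('n \<times> 'n)^('n \<times> 'n) \<Rightarrow>
    complex^('n \<times> 'n)^('n \<times> 'n) \<Rightarrow> (('n::finite) list \<Rightarrow> 'm::ab_group_add) \<Rightarrow> 'n list \<Rightarrow> 'm" where
  "St234 sc RVD RDD x =
     leg_apply sc 2 RVD (leg_apply sc 3 (matrix_inv RDD) (leg_apply sc 2 (matrix_inv RVD) x))"

definition T1234 :: "(complex \<Rightarrow> 'm \<Rightarrow> 'm) \<Rightarrow> complex^('n \<times> 'n)^('n \<times> 'n) \<Rightarrow>
    complex^('n \<times> 'n)^('n \<times> 'n) \<Rightarrow> complex^('n \<times> 'n)^('n \<times> 'n) \<Rightarrow>
    (('n::finite) list \<Rightarrow> 'm::ab_group_add) \<Rightarrow> 'n list \<Rightarrow> 'm" where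
  "T1234 sc RVV RVD RDD x = S123 sc RVV RVD (St234 sc RVD RDD x)"


section \<open>Algebras, modules and tensor products given by generators and relations\<close>

definition complex_algebra :: "(complex \<Rightarrow> 'b::ring_1 \<Rightarrow> 'b) \<Rightarrow> bool" where
  "complex_algebra sc \<longleftrightarrow> vector_space sc \<and>
     (\<forall>c x y. sc c (x * y) = sc c x * y \<and> sc c (x * y) = x * sc c y)"

text \<open>Words form the free monoid, so \<open>'g fword \<Rightarrow>\<^sub>0 complex\<close> is the free unital algebra on \<open>'g\<close>.\<close>

datatype 'g fword = FWord (letters: "'g list")

instantiation fword :: (type) monoid_add
begin

definition zero_fword :: "'a fword" where
  "zero_fword = FWord []"

definition plus_fword :: "'a fword \<Rightarrow> 'a fword \<Rightarrow> 'a fword" where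
  "plus_fword u v = FWord (letters u @ letters v)"

instance
  by standard (simp_all add: zero_fword_def plus_fword_def)

end

definition pm_scale :: "complex \<Rightarrow> ('k \<Rightarrow>\<^sub>0 complex) \<Rightarrow> ('k \<Rightarrow>\<^sub>0 complex)" where
  "pm_scale c f = Poly_Mapping.map ((*) c) f"

definition lin_extend :: "(complex \<Rightarrow> 'm \<Rightarrow> 'm) \<Rightarrow> ('k \<Rightarrow> 'm::ab_group_add) \<Rightarrow>
    ('k \<Rightarrow>\<^sub>0 complex) \<Rightarrow> 'm" where
  "lin_extend sc h f = (\<Sum>k\<in>Poly_Mapping.keys f. sc (Poly_Mapping.lookup f k) (h k))"

definition free_gen :: "'n \<Rightarrow> 'n \<Rightarrow> (('n \<times> 'n) fword \<Rightarrow>\<^sub>0 complex)" where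
  "free_gen i j = Poly_Mapping.single (FWord [(i, j)]) 1"

text \<open>
  The algebra \<open>'b\<close> is generated by \<open>p i j\<close> with defining relations \<open>x = 0\<close> for \<open>x\<close> in \<open>Rel\<close>:
  evaluation of the free algebra is onto, and its kernel is the two-sided ideal generated by \<open>Rel\<close>.
\<close>

definition presents_algebra :: "(complex \<Rightarrow> 'b::ring_1 \<Rightarrow> 'b) \<Rightarrow> ('n \<Rightarrow> 'n \<Rightarrow> 'b) \<Rightarrow>
    (('n \<times> 'n) fword \<Rightarrow>\<^sub>0 complex) set \<Rightarrow> bool" where
  "presents_algebra sc p Rel \<longleftrightarrow> complex_algebra sc \<and>
     (let eval = lin_extend sc (\<lambda>u. prod_list (map (\<lambda>(i, j). p i j) (letters u))) in
      surj eval \<and>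
      {f. eval f = 0} = module.span pm_scale {f * x * g | f x g. x \<in> Rel})"

locale algebra_bimodule =
  fixes sc :: "complex \<Rightarrow> 'b::ring_1 \<Rightarrow> 'b"
    and lact :: "'b \<Rightarrow> 'm::ab_group_add \<Rightarrow> 'm"
    and ract :: "'m \<Rightarrow> 'b \<Rightarrow> 'm"
  assumes lact_add: "lact (b + c) x = lact b x + lact c x" "lact b (x + y) = lact b x + lact b y"
    and lact_mult: "lact (b * c) x = lact b (lact c x)" "lact 1 x = x"
    and ract_add: "ract x (b + c) = ract x b + ract x c" "ract (x + y) b = ract x b + ract y b"
    and ract_mult: "ract x (b * c) = ract (ract x b) c" "ract x 1 = x"
    and lact_ract: "ract (lact b x) c = lact b (ract x c)"
    and scalars: "lact (sc z 1) x = ract x (sc z 1)"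

definition mod_scale :: "(complex \<Rightarrow> 'b::ring_1 \<Rightarrow> 'b) \<Rightarrow> ('b \<Rightarrow> 'm \<Rightarrow> 'm) \<Rightarrow> complex \<Rightarrow> 'm \<Rightarrow> 'm" where
  "mod_scale sc lact z x = lact (sc z 1) x"

text \<open>The free left module on pairs of indices is \<open>'b^('n \<times> 'n)\<close>, with \<open>b *s v\<close> as action.\<close>

definition free_scale :: "(complex \<Rightarrow> 'b \<Rightarrow> 'b) \<Rightarrow> complex \<Rightarrow> 'b^'g \<Rightarrow> 'b^'g" where
  "free_scale sc z v = (\<chi> g. sc z (v $ g))"

definition free_mod_gen :: "'n::finite \<Rightarrow> 'n \<Rightarrow> 'b::ring_1^('n \<times> 'n)" where
  "free_mod_gen i j = axis (i, j) 1"

definition presents_left_module :: "(complex \<Rightarrow> 'b::ring_1 \<Rightarrow> 'b) \<Rightarrow>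
    ('b \<Rightarrow> 'm::ab_group_add \<Rightarrow> 'm) \<Rightarrow> ('n::finite \<Rightarrow> 'n \<Rightarrow> 'm) \<Rightarrow> ('b^('n \<times> 'n)) set \<Rightarrow> bool" where
  "presents_left_module sc lact d Rel \<longleftrightarrow>
     (let eval = (\<lambda>v :: 'b^('n \<times> 'n). \<Sum>(i, j)\<in>UNIV. lact (v $ (i, j)) (d i j)) in
      surj eval \<and>
      {v. eval v = 0} = module.span (free_scale sc) {b *s x | b x. x \<in> Rel})"

text \<open>
  \<open>is_tensor_product sc lM rM lN rN lT rT tn\<close>: the bimodule \<open>'t\<close> with the map \<open>tn\<close> is the tensor
  product over \<open>'b\<close> of the bimodules \<open>'m\<close> and \<open>'n\<close>, that is the vector space generated by the
  symbols \<open>tn x y\<close> with biadditivity, homogeneity and balancedness as defining relations.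
\<close>

definition tensor_relations :: "(complex \<Rightarrow> 'b::ring_1 \<Rightarrow> 'b) \<Rightarrow>
    ('b \<Rightarrow> 'm \<Rightarrow> 'm) \<Rightarrow> ('m \<Rightarrow> 'b \<Rightarrow> 'm) \<Rightarrow> ('b \<Rightarrow> 'k \<Rightarrow> 'k) \<Rightarrow>
    (('m::ab_group_add \<times> 'k::ab_group_add) \<Rightarrow>\<^sub>0 complex) set" where
  "tensor_relations sc lM rM lN =
     (let S = (\<lambda>x y. Poly_Mapping.single (x, y) (1::complex)) in
        {S (x + x') y - S x y - S x' y | x x' y. True} \<union>
        {S x (y + y') - S x y - S x y' | x y y'. True} \<union>
        {S (mod_scale sc lM z x) y - pm_scale z (S x y) | z x y. True} \<union>
        {S (rM x b) y - S x (lN b y) | x b y. True})"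

definition is_tensor_product :: "(complex \<Rightarrow> 'b::ring_1 \<Rightarrow> 'b) \<Rightarrow>
    ('b \<Rightarrow> 'm \<Rightarrow> 'm) \<Rightarrow> ('m \<Rightarrow> 'b \<Rightarrow> 'm) \<Rightarrow> ('b \<Rightarrow> 'k \<Rightarrow> 'k) \<Rightarrow> ('k \<Rightarrow> 'b \<Rightarrow> 'k) \<Rightarrow>
    ('b \<Rightarrow> 't \<Rightarrow> 't) \<Rightarrow> ('t \<Rightarrow> 'b \<Rightarrow> 't) \<Rightarrow>
    ('m::ab_group_add \<Rightarrow> 'k::ab_group_add \<Rightarrow> 't::ab_group_add) \<Rightarrow> bool" where
  "is_tensor_product sc lM rM lN rN lT rT tn \<longleftrightarrow>
     algebra_bimodule sc lT rT \<and>
     (\<forall>b x y. lT b (tn x y) = tn (lM b x) y \<and> rT (tn x y) b = tn x (rN y b)) \<and>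
     (let eval = lin_extend (mod_scale sc lT) (\<lambda>(x, y). tn x y) in
      surj eval \<and>
      {f. eval f = 0} = module.span pm_scale (tensor_relations sc lM rM lN))"

definition lact_sum :: "('b \<Rightarrow> 'm \<Rightarrow> 'm) \<Rightarrow> ('b \<Rightarrow> 'k \<Rightarrow> 'k) \<Rightarrow> 'b \<Rightarrow> 'm \<times> 'k \<Rightarrow> 'm \<times> 'k" where
  "lact_sum lM lN b x = (lM b (fst x), lN b (snd x))"

definition ract_sum :: "('m \<Rightarrow> 'b \<Rightarrow> 'm) \<Rightarrow> ('k \<Rightarrow> 'b \<Rightarrow> 'k) \<Rightarrow> 'm \<times> 'k \<Rightarrow> 'b \<Rightarrow> 'm \<times> 'k" where
  "ract_sum rM rN x b = (rM (fst x) b, rN (snd x) b)"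

definition bimodule_map_to_algebra :: "('b::ring_1 \<Rightarrow> 't \<Rightarrow> 't) \<Rightarrow> ('t \<Rightarrow> 'b \<Rightarrow> 't) \<Rightarrow>
    ('t::ab_group_add \<Rightarrow> 'b) \<Rightarrow> bool" where
  "bimodule_map_to_algebra lT rT f \<longleftrightarrow>
     (\<forall>x y. f (x + y) = f x + f y) \<and>
     (\<forall>b x. f (lT b x) = b * f x) \<and> (\<forall>b x. f (rT x b) = f x * b)"


section \<open>Relations of the quantum projective space and its calculus\<close>

definition B_relations :: "nat \<Rightarrow> nat \<Rightarrow> real \<Rightarrow> ('n \<Rightarrow> weight) \<Rightarrow>
    complex^('n \<times> 'n)^('n \<times> 'n) \<Rightarrow> complex^('n \<times> 'n)^('n \<times> 'n) \<Rightarrow> complex^('n \<times> 'n)^('n \<times> 'n) \<Rightarrow>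
    (('n::finite \<times> 'n) fword \<Rightarrow>\<^sub>0 complex) set" where
  "B_relations r s q wt RVV RVD RDD =
     (let pp = family_prod (*) free_gen free_gen;
          w = w_const r s; m = m_const r s in
        components 4 (\<lambda>ls. S123 pm_scale RVV RVD pp ls - pm_scale (q_pow q w) (pp ls)) \<union>
        components 4 (\<lambda>ls. St234 pm_scale RVD RDD pp ls - pm_scale (q_pow q (- w)) (pp ls)) \<union>
        components 0 (\<lambda>ls. leg_contract pm_scale 1 (ev' r q wt) (family free_gen) ls
                            - pm_scale (q_pow q m) 1))"

definition Omega_plus_relations :: "nat \<Rightarrow> nat \<Rightarrow> real \<Rightarrow> ('n \<Rightarrow> weight) \<Rightarrow>
    complex^('n \<times> 'n)^('n \<times> 'n) \<Rightarrow> complex^('n \<times> 'n)^('n \<times> 'n) \<Rightarrow>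
    (complex \<Rightarrow> 'b \<Rightarrow> 'b) \<Rightarrow> ('n \<Rightarrow> 'n \<Rightarrow> 'b) \<Rightarrow> ('b::ring_1^('n::finite \<times> 'n)) set" where
  "Omega_plus_relations r s q wt RVD RDD sc p =
     (let pdp = family_prod (*s) p free_mod_gen; w = w_const r s in
        components 4 (\<lambda>ls. St234 (free_scale sc) RVD RDD pdp ls
                            - free_scale sc (q_pow q (- w)) (pdp ls)) \<union>
        components 0 (leg_contract (free_scale sc) 1 (ev' r q wt) (family free_mod_gen)))"

definition Omega_minus_relations :: "nat \<Rightarrow> nat \<Rightarrow> real \<Rightarrow> ('n \<Rightarrow> weight) \<Rightarrow>
    complex^('n \<times> 'n)^('n \<times> 'n) \<Rightarrow> complex^('n \<times> 'n)^('n \<times> 'n) \<Rightarrow>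
    (complex \<Rightarrow> 'b \<Rightarrow> 'b) \<Rightarrow> ('n \<Rightarrow> 'n \<Rightarrow> 'b) \<Rightarrow> ('b::ring_1^('n::finite \<times> 'n)) set" where
  "Omega_minus_relations r s q wt RVV RVD sc p =
     (let pdp = family_prod (*s) p free_mod_gen; w = w_const r s in
        components 4 (\<lambda>ls. S123 (free_scale sc) RVV RVD pdp ls
                            - free_scale sc (q_pow q w) (pdp ls)) \<union>
        components 0 (leg_contract (free_scale sc) 1 (ev' r q wt) (family free_mod_gen)))"

text \<open>$\mathsf{E}'_{12}\mathsf{E}_{23}\,x\otimes y$ for families \<open>x\<close>, \<open>y\<close>.\<close>

definition metric_part :: "nat \<Rightarrow> real \<Rightarrow> ('n::finite \<Rightarrow> weight) \<Rightarrow> (complex \<Rightarrow> 't \<Rightarrow> 't) \<Rightarrow>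
    ('m \<Rightarrow> 'm \<Rightarrow> 't::ab_group_add) \<Rightarrow> ('n \<Rightarrow> 'n \<Rightarrow> 'm) \<Rightarrow> ('n \<Rightarrow> 'n \<Rightarrow> 'm) \<Rightarrow> 't" where
  "metric_part r q wt sc tn x y =
     leg_contract sc 1 (ev' r q wt) (leg_contract sc 2 ev (family_prod tn x y)) []"

end

theory Submission
  imports Defs
begin

text \<open>
  Write $E$, $E'$ for the two contractions, $R$ for the braiding of $V$ with itself and $D$ for the
  braiding of $V$ with $V^*$, so that $S_{123} = D_{23} R_{12} D_{23}^{-1}$.  Applying the inverse
  metric to $g_{+-}$ or $g_{-+}$ means contracting a tensor in $V \otimes V^* \otimes V \otimes V^*$
  with $E'_{12} E_{23}$.  Everything rests on three properties of the braidings.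

  \<^item> Naturality: pulling $V$ through the invariant pairing $V \otimes V^* \to \mathbb{C}$ gives
    $E'_{12} D_{23} = E'_{23} R_{12}^{-1}$.
  \<^item> Both $E \circ D$ and $E'$ are invariant pairings of $V$ with $V^*$, so
    $E \circ D = \mu E'$ with a scalar $\mu$, namely $\mu = q^{-w-m}$.
  \<^item> Hecke relation: $R = h^2 R^{-1} + h (q - q^{-1})$ with $h = q^{-1/(r+1)}$.

  Hence $E'_{12} S_{123} = \mu^{-1} E_{23}$ and
  $E_{23} S_{123} = \mu h^2 E'_{12} + h (q - q^{-1}) E_{23}$
  (lemmas \<open>contract12_S\<close> and \<open>contract23_S\<close>).  The first identity, the relation
  $S_{123} pp = q^w pp$ and $E'_{12} p = q^m$ give $E_{23} pp = p$, so the term $pp$ of the inverse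
  metric contributes $q^m$.  The second identity evaluates the term $S_{123} C_3 p$ of the pairing of
  $\partial p$ with $\bar\partial p$; the term $C'_2 p$ of the other pairing only needs
  $\sum_i q^{-(\lambda_i, 2\rho)} = \mathrm{qdim}(V)$.  The closed form of the dimension follows from
  $\mathrm{qdim}(V) = [r+1]_q$.

  The three properties are read off from explicit matrices.  The highest weight vector of $V$
  generates a chain $e_1, \dots, e_{r+1}$ on which $E_i$ and $F_i$ are matrix units up to scalars; a
  dimension count turns this chain into the given weight basis up to scalars
  (\<open>simple_module_is_vector_rep\<close>).  The vector $e_1 \otimes u$ with $u$ of lowest weight generates
  the tensor product, so a braiding is the only intertwiner with the prescribed value there
  (\<open>intertwiner_unique\<close>), and it suffices to exhibit one
  (\<open>braiding_eq_braid\<close>, \<open>braiding_eq_braid_dual\<close>).  The case $s = r$ differs from $s = 1$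
  only by the diagram automorphism $i \mapsto r + 1 - i$, which also relates $V$ to $V^*$.
\<close>

section \<open>Weights of type $A_r$\<close>

lemma weight_form_simple_root:
  assumes "i \<in> {1..r}"
  shows "weight_form r (simple_root i) x = x i - x (i + 1)"
proof -
  have "weight_form r (simple_root i) x =
      (\<Sum>k=1..r+1. (if k = i then x k else 0) - (if k = i + 1 then x k else 0))"
    unfolding weight_form_def simple_root_def by (rule sum.cong) auto
  also have "\<dots> = x i - x (i + 1)"
    using assms by (auto simp: sum_subtractf)
  finally show ?thesis .
qed

lemma two_rho_coordinate:
  assumes "k \<in> {1..r+1}"
  shows "two_rho r k = real r + 2 - 2 * real k"
proof -
  have "(\<Sum>i=1..r. real i) = real r / 2 * real (r + 1)"
    by (induction r) (auto simp: field_simps)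
  then have mean: "(\<Sum>i=1..r. real i) / real (r + 1) = real r / 2"
    by (metis nonzero_mult_div_cancel_right of_nat_eq_0_iff add_is_0 one_neq_zero)
  have "(\<Sum>i=1..r. fund_weight r i k) =
      (\<Sum>i=1..r. if k \<le> i then 1 else 0) - (\<Sum>i=1..r. real i) / real (r + 1)"
    using assms by (simp add: fund_weight_def sum_subtractf sum_divide_distrib)
  also have "(\<Sum>i=1..r. if k \<le> i then 1 else (0::real)) = real (card ({1..r} \<inter> {i. k \<le> i}))"
    by (simp add: sum.If_cases)
  also have "{1..r} \<inter> {i. k \<le> i} = {k..r}" using assms by auto
  finally have "(\<Sum>i=1..r. fund_weight r i k) = real (r + 1) - real k - real r / 2"
    using assms by (simp add: mean[simplified] of_nat_diff)
  then show ?thesis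
    by (simp add: two_rho_def)
qed

text \<open>
  This is $2\rho = \sum_i i (r + 1 - i) \alpha_i$, proved by summation by parts.  It reduces the
  pairing with $2\rho$ to the numbers $(\alpha_i, x)$, which is all that the action of the $K_i$
  determines.
\<close>

lemma weight_form_two_rho:
  "weight_form r x (two_rho r) =
    (\<Sum>i=1..r. real i * (real r + 1 - real i) * weight_form r (simple_root i) x)"
proof -
  have parts: "(\<Sum>i=1..n. real i * (N - real i) * (x i - x (i + 1))) =
      (\<Sum>k=1..n+1. x k * (N + 1 - 2 * real k)) - x (n + 1) * (real n + 1) * (N - real n - 1)"
    for n and N :: real
    by (induction n) (auto simp: algebra_simps)
  have "(\<Sum>i=1..r. real i * (real r + 1 - real i) * weight_form r (simple_root i) x) =
      (\<Sum>i=1..r. real i * (real r + 1 - real i) * (x i - x (i + 1)))"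
    by (rule sum.cong) (auto simp: weight_form_simple_root)
  also have "\<dots> = (\<Sum>k=1..r+1. x k * (real r + 2 - 2 * real k))"
    unfolding parts by (simp add: algebra_simps)
  also have "\<dots> = weight_form r x (two_rho r)"
    unfolding weight_form_def by (rule sum.cong) (auto simp: two_rho_coordinate)
  finally show ?thesis by simp
qed

lemma simple_root_fund_weight:
  assumes "i \<in> {1..r}" "s \<in> {1..r}"
  shows "weight_form r (simple_root i) (fund_weight r s) = (if i = s then 1 else 0)"
  using assms by (auto simp: weight_form_simple_root fund_weight_def)

lemma simple_root_longest_fund_weight:
  assumes "i \<in> {1..r}" "s \<in> {1..r}"
  shows "weight_form r (simple_root i) (longest r (fund_weight r s)) =
      (if i + s = r + 1 then -1 else 0)"
  using assms by (auto simp: weight_form_simple_root fund_weight_def longest_def)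

lemma simple_root_simple_root:
  assumes "i \<in> {1..r}" "j \<in> {1..r}"
  shows "weight_form r (simple_root i) (simple_root j) =
    (if i = j then 2 else if i = j + 1 \<or> j = i + 1 then -1 else 0)"
  unfolding weight_form_simple_root[OF assms(1)] using assms by (auto simp: simple_root_def)

text \<open>
  The weights $\omega_1 = \epsilon_1 - t$ and $\omega_r = t - \epsilon_{r+1}$, where $t$ has all
  coordinates equal to $1 / (r + 1)$; sums over the coordinates then collapse to one or two terms.
\<close>

lemma fund_weight_extreme:
  assumes "1 \<le> r" "s \<in> {1, r}" "k \<in> {1..r+1}"
  shows "fund_weight r s k = (if s = 1 then (if k = 1 then 1 else 0) - 1 / real (r + 1)
     else 1 / real (r + 1) - (if k = r + 1 then 1 else 0))"
proof -
  have "real r / real (r + 1) = 1 - 1 / real (r + 1)" by (simp add: divide_simps)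
  then show ?thesis using assms by (auto simp: fund_weight_def simp del: of_nat_add)
qed

lemma w_const_extreme:
  assumes "1 \<le> r" "s \<in> {1, r}"
  shows "w_const r s = real r / real (r + 1)"
proof -
  define N where "N = real (r + 1)"
  have N: "N \<noteq> 0" by (simp add: N_def)
  define k0 where "k0 = (if s = 1 then 1 else r + 1)"
  have "w_const r s = (\<Sum>k=1..r+1. (if k = k0 then 1 - 2 / N else 0) + 1 / N\<^sup>2)"
    unfolding w_const_def weight_form_def
  proof (rule sum.cong, simp)
    fix k assume k: "k \<in> {1..r+1}"
    show "fund_weight r s k * fund_weight r s k = (if k = k0 then 1 - 2 / N else 0) + 1 / N\<^sup>2"
      using N unfolding fund_weight_extreme[OF assms k] k0_def N_def[symmetric]
      by (auto simp: power2_eq_square field_simps)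
  qed
  also have "\<dots> = (1 - 2 / N) + N * (1 / N\<^sup>2)"
    using assms by (simp add: sum.distrib k0_def N_def)
  also have "\<dots> = (N - 1) / N"
    using N by (simp add: power2_eq_square field_simps)
  finally show ?thesis by (simp add: N_def)
qed

lemma weight_form_longest_self:
  assumes "1 \<le> r" "s \<in> {1, r}"
  shows "weight_form r (fund_weight r s) (longest r (fund_weight r s)) = - (1 / real (r + 1))"
proof -
  define N where "N = real (r + 1)"
  have N: "N \<noteq> 0" by (simp add: N_def)
  have "weight_form r (fund_weight r s) (longest r (fund_weight r s)) =
     (\<Sum>k=1..r+1. 1 / N\<^sup>2 - (if k = 1 then 1 / N else 0) - (if k = r + 1 then 1 / N else 0))"
    unfolding weight_form_def
  proof (rule sum.cong, simp)
    fix k assume k: "k \<in> {1..r+1}"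
    then have k': "r + 2 - k \<in> {1..r+1}"
      and *: "r + 2 - k = 1 \<longleftrightarrow> k = r + 1" "r + 2 - k = r + 1 \<longleftrightarrow> k = 1"
      by auto
    have l: "longest r (fund_weight r s) k = fund_weight r s (r + 2 - k)"
      using k by (simp add: longest_def)
    show "fund_weight r s k * longest r (fund_weight r s) k =
        1 / N\<^sup>2 - (if k = 1 then 1 / N else 0) - (if k = r + 1 then 1 / N else 0)"
      using N assms(1)
      unfolding l fund_weight_extreme[OF assms k] fund_weight_extreme[OF assms k'] *
        N_def[symmetric]
      by (auto simp: power2_eq_square field_simps)
  qed
  also have "\<dots> = N * (1 / N\<^sup>2) - 1 / N - 1 / N"
    by (simp add: sum_subtractf N_def)
  also have "\<dots> = - (1 / N)"
    using N by (simp add: power2_eq_square field_simps)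
  finally show ?thesis by (simp add: N_def)
qed

lemma weight_form_longest_dual:
  assumes "1 \<le> r" "s \<in> {1, r}"
  shows "weight_form r (fund_weight r s) (longest r (fund_weight r (r + 1 - s))) = - w_const r s"
  unfolding w_const_def weight_form_def sum_negf[symmetric]
proof (rule sum.cong, simp)
  fix k assume k: "k \<in> {1..r+1}"
  then have k': "r + 2 - k \<in> {1..r+1}" and *: "r + 2 - k \<le> r + 1 - s \<longleftrightarrow> \<not> k \<le> s" using assms by auto
  have "fund_weight r (r + 1 - s) (r + 2 - k) = - fund_weight r s k"
    unfolding fund_weight_def using k k' assms by (auto simp: * field_simps)
  then show "fund_weight r s k * longest r (fund_weight r (r + 1 - s)) k =
      - (fund_weight r s k * fund_weight r s k)"
    using k by (simp add: longest_def)
qed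

lemma m_const_extreme:
  assumes "1 \<le> r" "s \<in> {1, r}"
  shows "m_const r s = real r"
proof -
  have s: "s \<in> {1..r}" using assms by auto
  have "m_const r s = (\<Sum>i=1..r. if i = s then real i * (real r + 1 - real i) else 0)"
    unfolding m_const_def weight_form_two_rho
    by (rule sum.cong) (use s in \<open>auto simp: simple_root_fund_weight\<close>)
  also have "\<dots> = real r"
    using assms by auto
  finally show ?thesis .
qed

lemma fund_weight_in_lattice:
  assumes "s \<in> {1..r}" shows "fund_weight r s \<in> weight_lattice r"
proof -
  have "fund_weight r s = (\<lambda>k. \<Sum>i=1..r. of_int (if i = s then 1 else 0) * fund_weight r i k)"
    using assms by (auto simp: fun_eq_iff if_distrib[of real_of_int] if_distrib[of "\<lambda>x. x * _"]
        cong: if_cong)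
  then show ?thesis unfolding weight_lattice_def by (intro CollectI exI)
qed

section \<open>Vector representations and their duals\<close>

lemma q_diff_neg:
  fixes q :: real
  assumes "0 < q" "q < 1" shows "q - inverse q < 0"
  using one_less_inverse[OF assms] assms by simp

lemma matrix_axis:
  fixes A :: "complex^'n::finite^'m::finite"
  shows "A *v axis y 1 = (\<chi> x. A $ x $ y)"
  by (simp add: vec_eq_iff matrix_vector_mult_def axis_def if_distrib[of "\<lambda>x. _ * x"] cong: if_cong)

lemma matrix_eq_on_axes:
  fixes A B :: "complex^'n::finite^'m::finite"
  assumes "\<And>x. A *v axis x 1 = B *v axis x 1"
  shows "A = B"
proof -
  have "A $ i $ j = (A *v axis j 1) $ i" "B $ i $ j = (B *v axis j 1) $ i" for i j
    by (simp_all add: matrix_axis)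
  then show ?thesis using assms by (simp add: vec_eq_iff)
qed

lemma scaleR_matrix_vector:
  fixes A :: "complex^'n::finite^'m::finite"
  shows "(a *\<^sub>R A) *v x = complex_of_real a *s (A *v x)"
  by (simp add: vec_eq_iff matrix_vector_mult_def sum_distrib_left
      scaleR_conv_of_real[where 'a=complex] mult.assoc)

lemma scaleR_eq_smult: "a *\<^sub>R (x :: complex^'n) = complex_of_real a *s x"
  by (auto simp: vec_eq_iff scaleR_conv_of_real[where 'a=complex])

text \<open>
  The identity or the nontrivial diagram automorphism; it lets $V(\omega_1)$ and $V(\omega_r)$ share
  one description.
\<close>

definition node :: "nat \<Rightarrow> bool \<Rightarrow> nat \<Rightarrow> nat" where
  "node r flip i = (if flip then r + 1 - i else i)"

lemma node_in: "i \<in> {1..r} \<Longrightarrow> node r flip i \<in> {1..r}"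
  by (auto simp: node_def)

lemma node_node: "i \<in> {1..r} \<Longrightarrow> node r flip (node r flip i) = i"
  by (auto simp: node_def)

lemma ball_nodeI:
  assumes "\<And>i. i \<in> {1..r} \<Longrightarrow> P (node r flip i)"
  shows "\<forall>i\<in>{1..r}. P i"
  by (metis assms node_in node_node)

lemma node_eq_iff: "i \<in> {1..r} \<Longrightarrow> j \<in> {1..r} \<Longrightarrow> node r flip i = node r flip j \<longleftrightarrow> i = j"
  by (metis node_node)

lemma node_adjacent:
  assumes "i \<in> {1..r}" "j \<in> {1..r}"
  shows "node r flip i = node r flip j + 1 \<or> node r flip j = node r flip i + 1 \<longleftrightarrow> i = j + 1 \<or> j =
      i + 1"
  using assms by (auto simp: node_def)

text \<open>
  The eigenvalue $q^{\delta_{ik} - \delta_{i+1,k}}$ of the $i$-th generator $K$ on the $k$-th basis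
  vector.
\<close>

definition kval :: "real \<Rightarrow> nat \<Rightarrow> nat \<Rightarrow> complex" where
  "kval q i k = (if k = i then complex_of_real q else if k = i + 1 then inverse (complex_of_real q)
      else 1)"

lemma kval_powr:
  assumes "0 < q"
  shows "kval q i k = complex_of_real (q powr ((if k = i then 1 else 0) - (if k = i + 1 then 1
      else 0)))"
  using assms by (auto simp: kval_def powr_minus)

text \<open>
  \<open>pos\<close> orders the basis by decreasing weight.  The scalars \<open>c\<close> record that the basis vectors are
  determined by their weights only up to rescaling.
\<close>

locale vector_rep =
  fixes r :: nat and q :: real and flip :: bool and pos :: "'n::finite \<Rightarrow> nat"
    and c :: "nat \<Rightarrow> complex" and M :: "'n uq_rep"
  assumes r_pos: "1 \<le> r" and q_pos: "0 < q" and q_less: "q < 1"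
    and pos_bij: "bij_betw pos UNIV {1..r+1}"
    and c_nonzero: "i \<in> {1..r} \<Longrightarrow> c i \<noteq> 0"
    and K_matrix: "i \<in> {1..r} \<Longrightarrow>
      actK M (node r flip i) = (\<chi> x y. if x = y then kval q i (pos x) else 0)"
    and Ki_matrix: "i \<in> {1..r} \<Longrightarrow>
      actKi M (node r flip i) = (\<chi> x y. if x = y then inverse (kval q i (pos x)) else 0)"
    and E_matrix: "i \<in> {1..r} \<Longrightarrow>
      actE M (node r flip i) = (\<chi> x y. if pos x = i \<and> pos y = i + 1 then c i else 0)"
    and F_matrix: "i \<in> {1..r} \<Longrightarrow>
      actF M (node r flip i) = (\<chi> x y. if pos x = i + 1 \<and> pos y = i then inverse (c i) else 0)"
begin

definition idx :: "nat \<Rightarrow> 'n" where "idx = inv_into UNIV pos"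

definition e :: "nat \<Rightarrow> complex^'n" where "e k = axis (idx k) 1"

lemma pos_in: "pos x \<in> {1..r+1}"
  using pos_bij by (auto simp: bij_betw_def)

lemma pos_idx [simp]: "k \<in> {1..r+1} \<Longrightarrow> pos (idx k) = k"
  unfolding idx_def by (rule f_inv_into_f) (use pos_bij in \<open>auto simp: bij_betw_def\<close>)

lemma idx_pos [simp]: "idx (pos x) = x"
  unfolding idx_def by (rule inv_into_f_f) (use pos_bij in \<open>auto simp: bij_betw_def\<close>)

lemma axis_eq_e: "axis x 1 = e (pos x)"
  by (simp add: e_def)

lemma matrix_eq_on_e:
  fixes A B :: "complex^'n^'m::finite"
  assumes "\<And>k. k \<in> {1..r+1} \<Longrightarrow> A *v e k = B *v e k"
  shows "A = B"
  by (rule matrix_eq_on_axes) (use assms pos_in in \<open>simp add: axis_eq_e\<close>)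

lemma kval_nonzero [simp]: "kval q i k \<noteq> 0"
  using q_pos by (simp add: kval_def)

lemma idx_eq_iff: "k \<in> {1..r+1} \<Longrightarrow> x = idx k \<longleftrightarrow> pos x = k"
  by auto

lemma K_e:
  assumes "i \<in> {1..r}" "k \<in> {1..r+1}"
  shows "actK M (node r flip i) *v e k = kval q i k *s e k"
  using assms unfolding e_def matrix_axis by (auto simp: K_matrix vec_eq_iff axis_def)

lemma Ki_e:
  assumes "i \<in> {1..r}" "k \<in> {1..r+1}"
  shows "actKi M (node r flip i) *v e k = inverse (kval q i k) *s e k"
  using assms unfolding e_def matrix_axis by (auto simp: Ki_matrix vec_eq_iff axis_def)

lemma E_e:
  assumes "i \<in> {1..r}" "k \<in> {1..r+1}"
  shows "actE M (node r flip i) *v e k = (if k = i + 1 then c i *s e i else 0)"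
  using assms unfolding e_def matrix_axis by (auto simp: E_matrix vec_eq_iff axis_def)

lemma F_e:
  assumes "i \<in> {1..r}" "k \<in> {1..r+1}"
  shows "actF M (node r flip i) *v e k = (if k = i then inverse (c i) *s e (i + 1) else 0)"
  using assms unfolding e_def matrix_axis
  by (auto simp: F_matrix vec_eq_iff axis_def) (metis idx_pos)

lemmas act_e = K_e Ki_e E_e F_e

lemma simple_root_node:
  assumes "i \<in> {1..r}" "j \<in> {1..r}"
  shows "weight_form r (simple_root (node r flip i)) (simple_root (node r flip j)) =
    (if i = j then 2 else if i = j + 1 \<or> j = i + 1 then -1 else 0)"
  unfolding simple_root_simple_root[OF node_in[OF assms(1)] node_in[OF assms(2)]]
    node_eq_iff[OF assms] node_adjacent[OF assms] ..

lemmas matrix_act = matrix_vector_mul_assoc[symmetric] vector_scalar_commute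
  matrix_vector_mult_add_rdistrib matrix_vector_mult_diff_rdistrib scaleR_matrix_vector

lemma uq_module: "is_uq_module r q M"
proof -
  let ?n = "node r flip"
  have Q: "complex_of_real q \<noteq> 0" using q_pos by simp
  have Q2: "complex_of_real q - inverse (complex_of_real q) \<noteq> 0"
  proof -
    have "q - inverse q \<noteq> 0" using q_diff_neg[OF q_pos q_less] by simp
    then show ?thesis by (metis of_real_diff of_real_eq_0_iff of_real_inverse)
  qed
  have unit: "actK M (?n i) ** actKi M (?n i) = mat 1" "actKi M (?n i) ** actK M (?n i) = mat 1"
    if "i \<in> {1..r}" for i
    by (rule matrix_eq_on_e, use that in \<open>simp add: act_e matrix_act\<close>)+
  have com: "actK M (?n i) ** actK M (?n j) = actK M (?n j) ** actK M (?n i)"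
    if "i \<in> {1..r}" "j \<in> {1..r}" for i j
    by (rule matrix_eq_on_e, use that in \<open>simp add: act_e matrix_act mult.commute\<close>)
  have KE: "actK M (?n i) ** actE M (?n j) ** actKi M (?n i) =
      (q powr weight_form r (simple_root (?n i)) (simple_root (?n j))) *\<^sub>R actE M (?n j)"
    if "i \<in> {1..r}" "j \<in> {1..r}" for i j
  proof (rule matrix_eq_on_e, cases)
    fix k assume k: "k \<in> {1..r+1}"
    assume "k = j + 1"
    moreover from this k that have "kval q i j * inverse (kval q i k) =
        complex_of_real (q powr weight_form r (simple_root (?n i)) (simple_root (?n j)))"
      using q_pos Q by (auto simp: simple_root_node kval_def powr_minus power2_eq_square)
    ultimately show "(actK M (?n i) ** actE M (?n j) ** actKi M (?n i)) *v e k = 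
       ((q powr weight_form r (simple_root (?n i)) (simple_root (?n j))) *\<^sub>R actE M (?n j)) *v e k"
      using that k by (simp add: act_e matrix_act) (simp add: mult.commute)
  qed (use that in \<open>simp add: act_e matrix_act\<close>)
  have KF: "actK M (?n i) ** actF M (?n j) ** actKi M (?n i) =
      (q powr (- weight_form r (simple_root (?n i)) (simple_root (?n j)))) *\<^sub>R actF M (?n j)"
    if "i \<in> {1..r}" "j \<in> {1..r}" for i j
  proof (rule matrix_eq_on_e, cases)
    fix k assume k: "k \<in> {1..r+1}"
    assume "k = j"
    moreover from this k that have "kval q i (j + 1) * inverse (kval q i k) =
        complex_of_real (q powr (- weight_form r (simple_root (?n i)) (simple_root (?n j))))"
      using q_pos Q by (auto simp: simple_root_node kval_def powr_minus power2_eq_square)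
    ultimately show "(actK M (?n i) ** actF M (?n j) ** actKi M (?n i)) *v e k = 
       ((q powr (- weight_form r (simple_root (?n i)) (simple_root (?n j)))) *\<^sub>R actF M (?n j)) *v
           e k"
      using that k by (simp add: act_e matrix_act) (simp add: mult.commute)
  qed (use that in \<open>simp add: act_e matrix_act\<close>)
  have EF: "actE M (?n i) ** actF M (?n j) - actF M (?n j) ** actE M (?n i) =
      (if ?n i = ?n j then inverse (q - inverse q) *\<^sub>R (actK M (?n i) - actKi M (?n i)) else 0)"
    if "i \<in> {1..r}" "j \<in> {1..r}" for i j
  proof (rule matrix_eq_on_e)
    fix k assume k: "k \<in> {1..r+1}"
    show "(actE M (?n i) ** actF M (?n j) - actF M (?n j) ** actE M (?n i)) *v e k =
      (if ?n i = ?n j then inverse (q - inverse q) *\<^sub>R (actK M (?n i) - actKi M (?n i))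
          else 0) *v e k"
    proof (cases "i = j")
      case True
      define z where "z = complex_of_real q - inverse (complex_of_real q)"
      have z: "z \<noteq> 0" using Q2 by (simp add: z_def)
      have "inverse z * (kval q i k - inverse (kval q i k)) =
          (if k = i then 1 else if k = i + 1 then -1 else 0)"
      proof -
        have "kval q i k - inverse (kval q i k) =
            (if k = i then z else if k = i + 1 then -z else 0)"
          by (simp add: kval_def z_def)
        then show ?thesis using z by simp
      qed
      then have "inverse z *s (kval q i k *s e k - inverse (kval q i k) *s e k) =
          (if k = i then 1 else if k = i + 1 then -1 else 0) *s e k"
        by (simp only: vector_sub_rdistrib[symmetric] vector_smult_assoc)
      then show ?thesis
        using that k True c_nonzero[of i]
        by (auto simp: act_e matrix_act z_def[symmetric])
    next
      case False
      then show ?thesis using that k by (auto simp: act_e matrix_act node_eq_iff)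
    qed
  qed
  have serreE: "q_serre r q (actE M)"
    unfolding q_serre_def
  proof (intro ball_nodeI[where flip = flip] conjI impI)
    fix i j assume ij: "i \<in> {1..r}" "j \<in> {1..r}"
    show "actE M (?n i) ** actE M (?n i) ** actE M (?n j)
        - (q + inverse q) *\<^sub>R (actE M (?n i) ** actE M (?n j) ** actE M (?n i))
        + actE M (?n j) ** actE M (?n i) ** actE M (?n i) = 0"
      by (rule matrix_eq_on_e) (use ij in \<open>auto simp: act_e matrix_act\<close>)
    assume "?n i \<noteq> ?n j \<and> ?n i \<noteq> ?n j + 1 \<and> ?n j \<noteq> ?n i + 1"
    then have "i \<noteq> j \<and> i \<noteq> j + 1 \<and> j \<noteq> i + 1"
      using ij node_adjacent[of i r j flip] by metis
    then show "actE M (?n i) ** actE M (?n j) = actE M (?n j) ** actE M (?n i)"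
      by (intro matrix_eq_on_e) (use ij in \<open>auto simp: act_e matrix_act\<close>)
  qed
  have serreF: "q_serre r q (actF M)"
    unfolding q_serre_def
  proof (intro ball_nodeI[where flip = flip] conjI impI)
    fix i j assume ij: "i \<in> {1..r}" "j \<in> {1..r}"
    show "actF M (?n i) ** actF M (?n i) ** actF M (?n j)
        - (q + inverse q) *\<^sub>R (actF M (?n i) ** actF M (?n j) ** actF M (?n i))
        + actF M (?n j) ** actF M (?n i) ** actF M (?n i) = 0"
      by (rule matrix_eq_on_e) (use ij in \<open>auto simp: act_e matrix_act\<close>)
    assume "?n i \<noteq> ?n j \<and> ?n i \<noteq> ?n j + 1 \<and> ?n j \<noteq> ?n i + 1"
    then have "i \<noteq> j \<and> i \<noteq> j + 1 \<and> j \<noteq> i + 1"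
      using ij node_adjacent[of i r j flip] by metis
    then show "actF M (?n i) ** actF M (?n j) = actF M (?n j) ** actF M (?n i)"
      by (intro matrix_eq_on_e) (use ij in \<open>auto simp: act_e matrix_act\<close>)
  qed
  show ?thesis
    unfolding is_uq_module_def
    by (intro conjI ball_nodeI[where flip = flip] serreE serreF unit com KE KF EF)
qed

lemma e_nonzero: "e k \<noteq> 0"
  by (simp add: e_def axis_eq_0_iff)

lemma highest_weight_e: "highest_weight_vector r q M (fund_weight r (node r flip 1)) (e 1)"
proof -
  have one: "1 \<in> {1..r}" using r_pos by simp
  have "actK M (node r flip i) *v e 1 =
      (q powr weight_form r (simple_root (node r flip i)) (fund_weight r (node r flip 1))) *\<^sub>R e 1"
    if i: "i \<in> {1..r}" for i
  proof -
    have "actK M (node r flip i) *v e 1 = kval q i 1 *s e 1" using K_e i by simp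
    moreover have "kval q i 1 = complex_of_real
        (q powr weight_form r (simple_root (node r flip i)) (fund_weight r (node r flip 1)))"
      using i q_pos unfolding simple_root_fund_weight[OF node_in[OF i] node_in[OF one]]
          node_eq_iff[OF i one]
      by (auto simp: kval_def)
    ultimately show ?thesis by (simp add: scaleR_eq_smult)
  qed
  moreover have "actE M (node r flip i) *v e 1 = 0" if i: "i \<in> {1..r}" for i
    using E_e i by simp
  ultimately show ?thesis
    unfolding highest_weight_vector_def has_weight_def
    by (intro conjI e_nonzero ball_nodeI[where flip = flip])
qed

lemma lowest_weight_e: "lowest_weight_vector r q M (longest r (fund_weight r (node r flip 1)))
    (e (r + 1))"
proof -
  have one: "1 \<in> {1..r}" using r_pos by simp
  have "actK M (node r flip i) *v e (r + 1) = (q powr weight_form r (simple_root (node r flip i))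
      (longest r (fund_weight r (node r flip 1)))) *\<^sub>R e (r + 1)"
    if i: "i \<in> {1..r}" for i
  proof -
    have "actK M (node r flip i) *v e (r + 1) = kval q i (r + 1) *s e (r + 1)" using K_e i by simp
    moreover have "node r flip i + node r flip 1 = r + 1 \<longleftrightarrow> i = r"
      using i by (auto simp: node_def)
    then have "kval q i (r + 1) = complex_of_real
        (q powr weight_form r (simple_root (node r flip i))
            (longest r (fund_weight r (node r flip 1))))"
      using i q_pos unfolding simple_root_longest_fund_weight[OF node_in[OF i] node_in[OF one]]
      by (auto simp: kval_def powr_minus)
    ultimately show ?thesis by (simp add: scaleR_eq_smult)
  qed
  moreover have "actF M (node r flip i) *v e (r + 1) = 0" if i: "i \<in> {1..r}" for i
    using F_e i by simp
  ultimately show ?thesis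
    unfolding lowest_weight_vector_def has_weight_def
    by (intro conjI e_nonzero ball_nodeI[where flip = flip])
qed

lemma E_rank_one:
  assumes "i \<in> {1..r}"
  shows "actE M (node r flip i) *v z = (c i * z $ idx (i + 1)) *s e i"
proof -
  have "(actE M (node r flip i) *v z) $ x =
      (\<Sum>y\<in>UNIV. if y = idx (i + 1) then (if pos x = i then c i * z $ y else 0) else 0)" for x
    unfolding E_matrix[OF assms] matrix_vector_mult_def vec_lambda_beta
    by (rule sum.cong) (use assms in \<open>auto simp: idx_eq_iff\<close>)
  then show ?thesis using assms by (auto simp: vec_eq_iff e_def axis_def idx_eq_iff)
qed

lemma F_rank_one:
  assumes "i \<in> {1..r}"
  shows "actF M (node r flip i) *v z = (inverse (c i) * z $ idx i) *s e (i + 1)"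
proof -
  have "(actF M (node r flip i) *v z) $ x =
      (\<Sum>y\<in>UNIV. if y = idx i then (if pos x = i + 1 then inverse (c i) * z $ y else 0)
      else 0)" for x
    unfolding F_matrix[OF assms] matrix_vector_mult_def vec_lambda_beta
    by (rule sum.cong) (use assms in \<open>auto simp: idx_eq_iff\<close>)
  then show ?thesis using assms by (auto simp: vec_eq_iff e_def axis_def idx_eq_iff)
qed

text \<open>
  Each $E_i$ and $F_i$ has rank one with image spanned by a basis vector, so a nonzero submodule
  contains some basis vector, and moving along the chain it contains all of them.
\<close>

lemma submodule_trivial:
  assumes W: "uq_submodule r M W"
  shows "W = {0} \<or> W = UNIV"
proof (rule ccontr)
  assume nt: "\<not> (W = {0} \<or> W = UNIV)"
  have sub: "vec.subspace W" using W by (simp add: uq_submodule_def)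
  then have "0 \<in> W" by (rule vec.subspace_0)
  with nt obtain z where z: "z \<in> W" "z \<noteq> 0" by auto
  have EW: "actE M (node r flip i) *v y \<in> W" and FW: "actF M (node r flip i) *v y \<in> W"
    if "y \<in> W" "i \<in> {1..r}" for y i
    using W that node_in[of i r flip] by (auto simp: uq_submodule_def)
  have descale: "y \<in> W" if "d *s y \<in> W" "d \<noteq> 0" for d and y :: "complex^'n"
    using vec.subspace_scale[OF sub that(1), of "inverse d"] that(2) by simp
  have up: "e (i + 1) \<in> W" if "y \<in> W" "y $ idx i \<noteq> 0" "i \<in> {1..r}" for y i
    using FW[OF that(1,3)] that c_nonzero[of i] by (auto simp: F_rank_one intro: descale)
  have down: "e i \<in> W" if "y \<in> W" "y $ idx (i + 1) \<noteq> 0" "i \<in> {1..r}" for y i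
    using EW[OF that(1,3)] that c_nonzero[of i] by (auto simp: E_rank_one intro: descale)
  have e_idx: "e k $ idx k \<noteq> 0" for k by (simp add: e_def)
  obtain a where a: "z $ a \<noteq> 0" using z(2) by (auto simp: vec_eq_iff)
  have "\<exists>k\<in>{1..r+1}. e k \<in> W"
  proof (cases "pos a \<le> r")
    case True
    then show ?thesis using up[OF z(1), of "pos a"] a pos_in[of a]
        by (intro bexI[of _ "pos a + 1"]) auto
  next
    case False
    then have "pos a = r + 1" using pos_in[of a] by auto
    then have "a = idx (r + 1)" by (metis idx_pos)
    then show ?thesis using down[OF z(1), of r] a r_pos
      by (intro bexI[of _ r]) auto
  qed
  then obtain k where k: "k \<in> {1..r+1}" "e k \<in> W" by auto
  have above: "l \<in> {k..r+1} \<longrightarrow> e l \<in> W" for l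
    by (induction l) (use k up[OF _ e_idx] in \<open>auto simp: le_Suc_eq\<close>)
  have top: "e (r + 1) \<in> W" using above[of "r + 1"] k by simp
  have "e l \<in> W" if "1 \<le> l" "l \<le> r + 1" for l
    using that(2,1)
  proof (induction rule: inc_induct)
    case base then show ?case using top by simp
  next
    case (step n)
    then show ?case using down[of "e (Suc n)" n] e_idx[of "Suc n"] by auto
  qed
  then have ax: "axis x 1 \<in> W" for x using pos_in[of x] by (simp add: axis_eq_e)
  have "x \<in> W" for x
  proof -
    have "(\<Sum>i\<in>UNIV. x $ i *s axis i 1) \<in> W"
      by (intro vec.subspace_sum[OF sub] vec.subspace_scale[OF sub] ax)
    then show ?thesis by (simp add: basis_expansion)
  qed
  then show False using nt by auto
qed

lemma simple_module: "is_simple_module r q M (fund_weight r (node r flip 1))"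
proof -
  have "node r flip 1 \<in> {1..r}" by (rule node_in) (use r_pos in auto)
  then show ?thesis unfolding is_simple_module_def
    using uq_module submodule_trivial highest_weight_e fund_weight_in_lattice by blast
qed

text \<open>
  Dualising reverses the chain and applies the diagram automorphism; the factor $-q$ comes from the
  antipode, $S(E_i) = - E_i K_i^{-1}$.
\<close>

lemma dual: "vector_rep r q (\<not> flip) (\<lambda>x. r + 2 - pos x) (\<lambda>i. -
    complex_of_real q * c (r + 1 - i)) (dual_rep M)"
proof
  show "1 \<le> r" "0 < q" "q < 1" by (fact r_pos q_pos q_less)+
  have "bij_betw (\<lambda>k. r + 2 - k) {1..r+1} {1..r+1}"
    by (rule bij_betw_byWitness[where f' = "\<lambda>k. r + 2 - k"]) auto
  from bij_betw_trans[OF pos_bij this]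
  show "bij_betw (\<lambda>x. r + 2 - pos x) UNIV {1..r+1}" by (simp add: o_def)
  fix i assume i: "i \<in> {1..r}"
  define j where "j = r + 1 - i"
  have j: "j \<in> {1..r}" "r + 1 - i = j" "i = r + 1 - j" using i by (auto simp: j_def)
  have n: "node r (\<not> flip) i = node r flip j" using i by (auto simp: node_def j_def)
  have p: "r + 2 - pos x = i \<longleftrightarrow> pos x = j + 1" "r + 2 - pos x = i + 1 \<longleftrightarrow> pos x = j" for x
    using pos_in[of x] i by (auto simp: j_def)
  have kv: "kval q i (r + 2 - pos x) = inverse (kval q j (pos x))" for x
    unfolding kval_def p using j by auto
  show "- complex_of_real q * c (r + 1 - i) \<noteq> 0" using q_pos c_nonzero j by simp
  show "actK (dual_rep M) (node r (\<not> flip) i) =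
      (\<chi> x y. if x = y then kval q i (r + 2 - pos x) else 0)"
    unfolding n dual_rep_def kv using Ki_matrix[OF j(1)] by (auto simp: transpose_def vec_eq_iff)
  show "actKi (dual_rep M) (node r (\<not> flip) i) =
      (\<chi> x y. if x = y then inverse (kval q i (r + 2 - pos x)) else 0)"
    unfolding n dual_rep_def kv using K_matrix[OF j(1)] by (auto simp: transpose_def vec_eq_iff)
  show "actE (dual_rep M) (node r (\<not> flip) i) =
      (\<chi> x y. if r + 2 - pos x = i \<and> r + 2 - pos y = i + 1 then - complex_of_real q * c (r + 1 - i)
          else 0)"
  proof -
    have "(actE M (node r flip j) ** actKi M (node r flip j)) $ y $ x =
       (if pos y = j \<and> pos x = j + 1 then c j * inverse (kval q j (pos x)) else 0)" for x y
      unfolding E_matrix[OF j(1)] Ki_matrix[OF j(1)]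
      by (simp add: matrix_matrix_mult_def if_distrib[of "\<lambda>x. _ * x"] cong: if_cong)
    then show ?thesis unfolding n j(2) p
        by (auto simp: dual_rep_def transpose_def vec_eq_iff kval_def)
  qed
  show "actF (dual_rep M) (node r (\<not> flip) i) =
      (\<chi> x y. if r + 2 - pos x = i + 1 \<and> r + 2 -
          pos y = i then inverse (- complex_of_real q * c (r + 1 - i)) else 0)"
  proof -
    have "(actK M (node r flip j) ** actF M (node r flip j)) $ y $ x =
       (if pos y = j + 1 \<and> pos x = j then kval q j (pos y) * inverse (c j) else 0)" for x y
      unfolding F_matrix[OF j(1)] K_matrix[OF j(1)]
      by (simp add: matrix_matrix_mult_def if_distrib[of "\<lambda>x. x * _"] cong: if_cong)
    then show ?thesis unfolding n j(2) p
        by (auto simp: dual_rep_def transpose_def vec_eq_iff kval_def)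
  qed
qed

end

section \<open>The structure of the simple module\<close>

text \<open>
  A representation of $U_q(\mathfrak{sl}_2)$ on which $K$ acts diagonally.  Diagonality makes the set
  of exponents \<open>d\<close> finite, which takes the place of a linear independence argument for strings of
  weight vectors.
\<close>

locale diagonal_sl2 =
  fixes q :: real and K Ki E F :: "complex^'n::finite^'n" and d :: "'n \<Rightarrow> real"
  assumes q_pos: "0 < q" and q_less: "q < 1"
    and K_diag: "(K *v y) $ a = complex_of_real (q powr d a) * y $ a"
    and Ki_K: "Ki ** K = mat 1"
    and KFKi: "K ** F ** Ki = (q powr (-2)) *\<^sub>R F"
    and EF: "E ** F - F ** E = inverse (q - inverse q) *\<^sub>R (K - Ki)"
begin

lemma Ki_eigen:
  assumes "K *v y = complex_of_real (q powr t) *s y"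
  shows "Ki *v y = complex_of_real (q powr (-t)) *s y"
proof -
  have "Ki *v (K *v y) = y" by (simp add: matrix_vector_mul_assoc Ki_K)
  then have "complex_of_real (q powr t) *s (Ki *v y) = y"
    using assms by (simp add: vector_scalar_commute)
  moreover have "complex_of_real (q powr (-t)) * complex_of_real (q powr t) = 1"
    using q_pos by (simp flip: of_real_mult powr_add)
  ultimately show ?thesis by (metis vector_smult_assoc vector_smult_lid)
qed

lemma F_eigen:
  assumes "K *v y = complex_of_real (q powr t) *s y"
  shows "K *v (F *v y) = complex_of_real (q powr (t - 2)) *s (F *v y)"
proof -
  have "K *v (F *v y) = (K ** F ** Ki) *v (K *v y)"
    by (metis Ki_K matrix_mul_assoc matrix_mul_rid matrix_vector_mul_assoc)
  also have "\<dots> = complex_of_real (q powr (-2) * q powr t) *s (F *v y)"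
    unfolding KFKi assms by (simp add: scaleR_matrix_vector vector_scalar_commute)
  finally show ?thesis using q_pos by (simp flip: powr_add)
qed

lemma E_F:
  assumes "K *v y = complex_of_real (q powr t) *s y"
  shows "E *v (F *v y) = F *v (E *v y) + complex_of_real (q_num q t) *s y"
proof -
  have "E *v (F *v y) = F *v (E *v y) + (E ** F - F ** E) *v y"
    by (simp add: matrix_vector_mult_diff_rdistrib flip: matrix_vector_mul_assoc)
  also have "(E ** F - F ** E) *v y = complex_of_real (inverse (q - inverse q)) *s
      (complex_of_real (q powr t) *s y - complex_of_real (q powr (-t)) *s y)"
    unfolding EF by (simp add: scaleR_matrix_vector matrix_vector_mult_diff_rdistrib assms
        Ki_eigen[OF assms])
  also have "\<dots> = complex_of_real (q_num q t) *s y"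
    by (simp add: q_num_def vec_eq_iff divide_inverse algebra_simps)
  finally show ?thesis .
qed

lemma q_num_neg:
  assumes "t < 0" shows "q_num q t < 0"
proof -
  have "q powr (-t) < q powr t" using q_pos q_less assms by (simp add: powr_less_mono')
  then show ?thesis unfolding q_num_def using q_diff_neg[OF q_pos q_less]
      by (simp add: divide_pos_neg)
qed

text \<open>
  On the string $F^k y$ one has $E F^{k+1} y = b_k F^k y$, where $b_k$ is a sum of quantum integers
  $[t - 2j]_q$.  These are all negative when $t < 0$, so no $F^k y$ would vanish, and $K$ would have
  infinitely many eigenvalues.
\<close>

lemma no_negative_highest_weight:
  assumes Ky: "K *v y = complex_of_real (q powr t) *s y" and Ey: "E *v y = 0" and t: "t < 0"
  shows "y = 0"
proof (rule ccontr)
  assume y: "y \<noteq> 0"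
  define z where "z k = ((\<lambda>x. F *v x) ^^ k) y" for k
  have z_Suc: "z (Suc k) = F *v z k" and z_0: "z 0 = y" for k by (simp_all add: z_def)
  have Kz: "K *v z k = complex_of_real (q powr (t - 2 * real k)) *s z k" for k
  proof (induction k)
    case 0 then show ?case using Ky by (simp add: z_0)
  next
    case (Suc k)
    show ?case using F_eigen[OF Suc] by (simp add: z_Suc algebra_simps)
  qed
  define b where "b k = (\<Sum>j\<le>k. q_num q (t - 2 * real j))" for k
  have Ez: "E *v z (Suc k) = complex_of_real (b k) *s z k" for k
  proof (induction k)
    case 0
    then show ?case using E_F[OF Kz[of 0]] Ey by (simp add: z_Suc z_0 b_def)
  next
    case (Suc k)
    have "E *v z (Suc (Suc k)) = F *v (complex_of_real (b k) *s z k)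
        + complex_of_real (q_num q (t - 2 * real (Suc k))) *s z (Suc k)"
      using E_F[OF Kz[of "Suc k"]] Suc by (simp add: z_Suc)
    also have "\<dots> = complex_of_real (b (Suc k)) *s z (Suc k)"
      by (simp add: vector_scalar_commute b_def vector_sadd_rdistrib flip: z_Suc)
    finally show ?case .
  qed
  have b_neg: "b k < 0" for k
  proof (induction k)
    case 0 then show ?case using q_num_neg[OF t] by (simp add: b_def)
  next
    case (Suc k)
    have "q_num q (t - 2 * real (Suc k)) < 0" using t by (intro q_num_neg) simp
    then show ?case using Suc by (simp add: b_def)
  qed
  have z_nonzero: "z k \<noteq> 0" for k
  proof (induction k)
    case (Suc k)
    have "complex_of_real (b k) *s z k \<noteq> 0" using b_neg[of k] Suc by simp
    then show ?case using Ez[of k] by auto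
  qed (simp add: z_0 y)
  have "t - 2 * real k \<in> range d" for k
  proof -
    obtain a where a: "z k $ a \<noteq> 0" using z_nonzero[of k] by (auto simp: vec_eq_iff)
    have "complex_of_real (q powr d a) * z k $ a =
        complex_of_real (q powr (t - 2 * real k)) * z k $ a"
      using K_diag[of "z k" a] Kz[of k] by auto
    then have "q powr d a = q powr (t - 2 * real k)" using a by simp
    then have "d a = t - 2 * real k" using q_pos q_less by (simp add: powr_inj)
    then show ?thesis by (metis rangeI)
  qed
  then have "range (\<lambda>k. t - 2 * real k) \<subseteq> range d" by auto
  then have "finite (range (\<lambda>k. t - 2 * real k))" by (rule finite_subset) simp
  moreover have "inj (\<lambda>k::nat. t - 2 * real k)" by (auto intro: injI)
  ultimately show False using finite_imageD by blast
qed

text \<open>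
  In weight 0, and likewise in weight 1 after one more step, applying $F$ to a highest weight vector
  yields a highest weight vector of negative weight, which must vanish.
\<close>

lemma F_kills_weight_0:
  assumes "K *v y = y" "E *v y = 0"
  shows "F *v y = 0"
proof (rule no_negative_highest_weight)
  have K: "K *v y = complex_of_real (q powr 0) *s y" using assms q_pos by simp
  show "K *v (F *v y) = complex_of_real (q powr (0 - 2)) *s (F *v y)" by (rule F_eigen[OF K])
  show "E *v (F *v y) = 0" using E_F[OF K] assms by (simp add: q_num_def)
qed simp

lemma F_F_kills_weight_1:
  assumes "K *v y = complex_of_real q *s y" "E *v y = 0"
  shows "E *v (F *v y) = y" "F *v (F *v y) = 0"
proof -
  have K: "K *v y = complex_of_real (q powr 1) *s y" using assms q_pos by simp
  have q1: "q_num q 1 = 1" "q_num q (-1) = -1"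
    using q_diff_neg[OF q_pos q_less] q_pos by (simp_all add: q_num_def powr_minus divide_simps)
  show EFy: "E *v (F *v y) = y" using E_F[OF K] assms by (simp add: q1)
  have K2: "K *v (F *v y) = complex_of_real (q powr (-1)) *s (F *v y)"
    using F_eigen[OF K] by simp
  show "F *v (F *v y) = 0"
  proof (rule no_negative_highest_weight)
    show "K *v (F *v (F *v y)) = complex_of_real (q powr (-1 - 2)) *s (F *v (F *v y))"
      by (rule F_eigen[OF K2])
    show "E *v (F *v (F *v y)) = 0" using E_F[OF K2] by (simp add: EFy q1)
  qed simp
qed

end

lemma kval_step:
  assumes "i \<in> {1..r}" "j \<in> {1..r}" "0 < q"
  shows "complex_of_real (q powr (- (if i = j then 2 else if i = j + 1 \<or> j = i + 1 then -1
      else 0))) * kval q i j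
    = kval q i (j + 1)"
  using assms by (auto simp: kval_def powr_minus power2_eq_square)

text \<open>
  Put $u_0 = v_0$ and $u_{k+1} = F_{k+1} u_k$.  By induction $u_k$ has the weight of the $k$-th step
  of the chain, and the relation for $[E_i, F_j]$ together with the $\mathfrak{sl}_2$ lemmas shows
  $E_k u_k = u_{k-1}$ and that all other generators annihilate $u_k$ except $F_{k+1}$.  The $r + 1$
  vectors $u_k$ have distinct weights, hence disjoint supports in the weight basis; as the basis has
  $r + 1$ elements, each support is a single basis vector.
\<close>

lemma simple_module_is_vector_rep:
  fixes V :: "('n::finite) uq_rep"
  assumes r: "1 \<le> r" and s: "s \<in> {1, r}" and q: "0 < q" "q < 1" and card: "CARD('n) = r + 1"
    and uq: "is_uq_module r q V" and hw: "highest_weight_vector r q V (fund_weight r s) v0"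
    and wb: "is_weight_basis r q V wt"
  obtains pos c where "vector_rep r q (s \<noteq> 1) pos c V"
proof -
  (* Relabelled by n, the generators act on V(omega_r) as they do on V(omega_1). *)
  define n where "n = node r (s \<noteq> 1)"
  have n_in: "n i \<in> {1..r}" if "i \<in> {1..r}" for i using node_in[OF that] by (simp add: n_def)
  have n1: "n 1 = s" using s by (auto simp: n_def node_def)
  have n_eq: "n i = n j \<longleftrightarrow> i = j" if "i \<in> {1..r}" "j \<in> {1..r}" for i j
    using node_eq_iff[OF that] by (simp add: n_def)
  define K where "K i = actK V (n i)" for i
  define Ki where "Ki i = actKi V (n i)" for i
  define E where "E i = actE V (n i)" for i
  define F where "F i = actF V (n i)" for i
  define D where "D i x = weight_form r (simple_root (n i)) (wt x)" for i x
  have K_axis: "K i *v axis x 1 = complex_of_real (q powr D i x) *s axis x 1"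
      if "i \<in> {1..r}" for i x
    using wb n_in[OF that] by (simp add: is_weight_basis_def has_weight_def K_def D_def
        scaleR_eq_smult)
  have K_entry: "K i $ x $ y = (if x = y then complex_of_real (q powr D i y) else 0)"
      if "i \<in> {1..r}" for i x y
    using K_axis[OF that, of y] unfolding matrix_axis by (auto simp: vec_eq_iff axis_def)
  have K_diag: "(K i *v y) $ x = complex_of_real (q powr D i x) * y $ x" if "i \<in> {1..r}" for i x y
    using that by (simp add: matrix_vector_mult_def K_entry if_distrib[of "\<lambda>x. x * _"] cong:
        if_cong)
  have inv: "K i ** Ki i = mat 1" "Ki i ** K i = mat 1" if "i \<in> {1..r}" for i
    using uq n_in[OF that] by (auto simp: is_uq_module_def K_def Ki_def)
  have sr: "weight_form r (simple_root (n i)) (simple_root (n j)) =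
      (if i = j then 2 else if i = j + 1 \<or> j = i + 1 then -1 else 0)"
          if "i \<in> {1..r}" "j \<in> {1..r}" for i j
    using simple_root_simple_root[OF n_in[OF that(1)] n_in[OF that(2)]] n_eq[OF that]
      node_adjacent[OF that, of "s \<noteq> 1"] by (simp add: n_def)
  have KF: "K i ** F j ** Ki i = (q powr (- weight_form r (simple_root (n i)) (simple_root (n j))))
      *\<^sub>R F j"
    if "i \<in> {1..r}" "j \<in> {1..r}" for i j
    using uq n_in[OF that(1)] n_in[OF that(2)] by (simp add: is_uq_module_def K_def Ki_def F_def)
  have EF: "E i ** F j - F j ** E i = (if i = j then inverse (q - inverse q) *\<^sub>R (K i - Ki i)
      else 0)"
    if "i \<in> {1..r}" "j \<in> {1..r}" for i j
    using uq n_in[OF that(1)] n_in[OF that(2)] n_eq[OF that]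
    by (simp add: is_uq_module_def K_def Ki_def F_def E_def)
  have sl2: "diagonal_sl2 q (K i) (Ki i) (E i) (F i) (D i)" if i: "i \<in> {1..r}" for i
    by unfold_locales (use q K_diag[OF i] inv(2)[OF i] KF[OF i i] EF[OF i i] sr[OF i i] in auto)

  define u where "u = rec_nat v0 (\<lambda>k y. F (Suc k) *v y)"
  have u0: "u 0 = v0" and uS: "u (Suc k) = F (Suc k) *v u k" for k by (simp_all add: u_def)
  define good where "good k \<longleftrightarrow> u k \<noteq> 0 \<and> (\<forall>i\<in>{1..r}. K i *v u k = kval q i (k + 1) *s u k \<and>
      E i *v u k = (if i = k then u (k - 1) else 0) \<and>
      (i \<noteq> k + 1 \<longrightarrow> F i *v u k = 0))" for k
  have good: "good k" if "k \<le> r" for k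
    using that
  proof (induction k rule: less_induct)
    case (less k)
    show ?case
    proof (cases k)
      case 0
      have K0: "K i *v u 0 = kval q i 1 *s u 0" and E0: "E i *v u 0 = 0" if i: "i \<in> {1..r}" for i
      proof -
        have "K i *v v0 = complex_of_real (q powr (if n i = s then 1 else 0)) *s v0"
          using hw n_in[OF i] s r simple_root_fund_weight[OF n_in[OF i], of s]
          by (auto simp: highest_weight_vector_def has_weight_def K_def scaleR_eq_smult)
        moreover have "n i = s \<longleftrightarrow> i = 1" using n_eq[OF i, of 1] n1 r by auto
        ultimately show "K i *v u 0 = kval q i 1 *s u 0" using i q by (auto simp: u0 kval_def)
        show "E i *v u 0 = 0" using hw n_in[OF i] by (simp add: u0 E_def highest_weight_vector_def)
      qed
      have "F i *v u 0 = 0" if i: "i \<in> {1..r}" "i \<noteq> 1" for i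
        by (rule diagonal_sl2.F_kills_weight_0[OF sl2[OF i(1)]])
          (use K0[OF i(1)] E0[OF i(1)] i in \<open>auto simp: kval_def\<close>)
      then show ?thesis using K0 E0 hw
        by (auto simp: good_def 0 highest_weight_vector_def u0)
    next
      case (Suc l)
      define j where "j = Suc l"
      have j: "j \<in> {1..r}" using less.prems by (simp add: Suc j_def)
      have gl: "good l" using less.IH[of l] less.prems Suc by simp
      have uj: "u j = F j *v u l" by (simp add: j_def uS)
      have Kl: "K i *v u l = kval q i j *s u l" if "i \<in> {1..r}" for i
        using gl that by (simp add: good_def j_def)
      have El: "E i *v u l = (if i = l then u (l - 1) else 0)" if "i \<in> {1..r}" for i
        using gl that by (simp add: good_def)
      have Kj: "K i *v u j = kval q i (j + 1) *s u j" if i: "i \<in> {1..r}" for i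
      proof -
        have "K i *v u j = (K i ** F j ** Ki i) *v (K i *v u l)"
          unfolding uj by (metis inv(2)[OF i] matrix_mul_assoc matrix_mul_rid
              matrix_vector_mul_assoc)
        also have "\<dots> = (complex_of_real (q powr (- (if i = j then 2
            else if i = j + 1 \<or> j = i + 1 then -1 else 0))) * kval q i j) *s u j"
          unfolding KF[OF i j] sr[OF i j] Kl[OF i] uj
          by (simp only: scaleR_matrix_vector vector_scalar_commute vector_smult_assoc mult.commute)
        finally show ?thesis unfolding kval_step[OF i j q(1)] .
      qed
      have lj: "K j *v u l = complex_of_real q *s u l" "E j *v u l = 0"
        using Kl[OF j] El[OF j] by (auto simp: kval_def j_def)
      have Ej: "E i *v u j = (if i = j then u l else 0)" if i: "i \<in> {1..r}" for i
      proof (cases "i = j")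
        case True
        then show ?thesis using diagonal_sl2.F_F_kills_weight_1(1)[OF sl2[OF j] lj]
            by (simp add: uj)
      next
        case False
        have "E i *v u j = F j *v (E i *v u l) + (E i ** F j - F j ** E i) *v u l"
          by (simp add: uj matrix_vector_mult_diff_rdistrib flip: matrix_vector_mul_assoc)
        also have "\<dots> = F j *v (E i *v u l)" unfolding EF[OF i j] using False by simp
        also have "\<dots> = 0"
        proof (cases "i = l")
          case True
          then have "good (l - 1)" "j \<noteq> (l - 1) + 1" using less.IH[of "l - 1"] less.prems Suc i
              by (auto simp: j_def)
          then have "F j *v u (l - 1) = 0" using j by (simp add: good_def)
          then show ?thesis using True El[OF i] by simp
        qed (simp add: El[OF i])
        finally show ?thesis using False by simp
      qed
      have "F i *v u j = 0" if i: "i \<in> {1..r}" "i \<noteq> j + 1" for i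
      proof (cases "i = j")
        case True
        then show ?thesis using diagonal_sl2.F_F_kills_weight_1(2)[OF sl2[OF j] lj]
            by (simp add: uj)
      next
        case False
        show ?thesis
          by (rule diagonal_sl2.F_kills_weight_0[OF sl2[OF i(1)]])
            (use Kj[OF i(1)] Ej[OF i(1)] i False in \<open>auto simp: kval_def\<close>)
      qed
      moreover have "u j \<noteq> 0" using Ej[OF j] gl by (auto simp: good_def)
      moreover have "k = j" using Suc by (simp add: j_def)
      ultimately show ?thesis using Kj Ej by (auto simp: good_def j_def)
    qed
  qed

  (* Each u k is supported on the basis vectors with its weight.  For k < l the weights differ:
     K (k + 1) has eigenvalue q on u k but not on u l. *)
  have eigen: "complex_of_real (q powr D i x) = kval q i (k + 1)"
    if "k \<le> r" "u k $ x \<noteq> 0" "i \<in> {1..r}" for k x i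
  proof -
    have "K i *v u k = kval q i (k + 1) *s u k" using good[OF that(1)] that(3)
        by (simp add: good_def)
    then show ?thesis using K_diag[OF that(3), of "u k" x] that(2) by simp
  qed
  have less_sep: False if "k < l" "l \<le> r" "u k $ x \<noteq> 0" "u l $ x \<noteq> 0" for k l x
  proof -
    have "kval q (k + 1) (k + 1) = kval q (k + 1) (l + 1)"
      using eigen[of k x "k + 1"] eigen[of l x "k + 1"] that by simp
    moreover have "q \<noteq> inverse q" using q_diff_neg[OF q] by auto
    then have "complex_of_real q \<noteq> inverse (complex_of_real q)"
      by (metis of_real_eq_iff of_real_inverse)
    ultimately show False using that q by (auto simp: kval_def split: if_splits)
  qed
  have sep: "k = l" if "k \<le> r" "l \<le> r" "u k $ x \<noteq> 0" "u l $ x \<noteq> 0" for k l x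
    using less_sep[of k l x] less_sep[of l k x] that by (cases k l rule: linorder_cases) auto
  have "\<exists>x. u k $ x \<noteq> 0" if "k \<le> r" for k
    using good[OF that] by (auto simp: good_def vec_eq_iff)
  then obtain b where b: "u k $ b k \<noteq> 0" if "k \<le> r" for k by metis
  have inj: "inj_on b {..r}"
    by (rule inj_onI) (metis atMost_iff b sep)
  have img: "b ` {..r} = UNIV"
    by (rule card_subset_eq) (use card card_image[OF inj] in auto)
  (* u is indexed from 0, positions from 1. *)
  define pos where "pos x = Suc (inv_into {..r} b x)" for x
  have pos_b: "pos (b k) = k + 1" if "k \<le> r" for k
    using inv_into_f_f[OF inj, of k] that by (simp add: pos_def)
  have b_pos: "b (pos x - 1) = x" "pos x - 1 \<le> r" "1 \<le> pos x" for x
    using f_inv_into_f[of x b "{..r}"] inv_into_into[of x b "{..r}"] img by (auto simp: pos_def)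
  define t where "t k = u k $ b k" for k
  have t: "t k \<noteq> 0" if "k \<le> r" for k using b that by (simp add: t_def)
  have u_axis: "u k = t k *s axis (b k) 1" if k: "k \<le> r" for k
  proof -
    have "u k $ x = 0" if x: "x \<noteq> b k" for x
    proof (rule ccontr)
      assume "u k $ x \<noteq> 0"
      moreover have "u (pos x - 1) $ x \<noteq> 0" using b[OF b_pos(2)[of x]] unfolding b_pos(1) .
      ultimately have "k = pos x - 1" using sep[OF k b_pos(2)[of x]] by blast
      then show False using x b_pos(1)[of x] by simp
    qed
    then show ?thesis by (auto simp: vec_eq_iff axis_def t_def)
  qed
  have axis_u: "axis (b k) 1 = inverse (t k) *s u k" if "k \<le> r" for k
    using t[OF that] by (simp add: u_axis[OF that])
  define c where "c i = inverse (t i) * t (i - 1)" for i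
  have "vector_rep r q (s \<noteq> 1) pos c V"
  proof
    show "1 \<le> r" "0 < q" "q < 1" by fact+
    show "bij_betw pos UNIV {1..r+1}"
    proof -
      have inj_pos: "inj pos" by (rule injI) (metis b_pos(1))
      have "pos x \<in> {1..r+1}" for x using b_pos(2)[of x] b_pos(3)[of x] by simp
      then have "range pos = {1..r+1}"
        using card card_image[OF inj_pos] by (intro card_subset_eq) auto
      then show ?thesis using inj_pos by (simp add: bij_betw_def)
    qed
    fix i assume i: "i \<in> {1..r}"
    show "c i \<noteq> 0" using t i by (auto simp: c_def)
    have col: "A $ x $ y = (A *v axis (b (pos y - 1)) 1) $ x" for A :: "complex^'n^'n" and x y
      by (simp only: matrix_axis b_pos vec_lambda_beta)
    have b_eq: "x = b k \<longleftrightarrow> pos x = k + 1" if "k \<le> r" for x k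
    proof
      show "pos x = k + 1" if "x = b k" using that pos_b[OF \<open>k \<le> r\<close>] by simp
      show "x = b k" if "pos x = k + 1" using b_pos(1)[of x] that by simp
    qed
    show Km: "actK V (node r (s \<noteq> 1) i) = (\<chi> x y. if x = y then kval q i (pos x) else 0)"
    proof -
      have "complex_of_real (q powr D i y) = kval q i (pos y)" for y
      proof -
        have "u (pos y - 1) $ y \<noteq> 0" using b[OF b_pos(2)[of y]] unfolding b_pos(1) .
        moreover have "pos y - 1 + 1 = pos y" using b_pos(3)[of y] by simp
        ultimately show ?thesis using eigen[OF b_pos(2)[of y] _ i, of y] by simp
      qed
      then show ?thesis using K_entry[OF i] by (auto simp: vec_eq_iff K_def n_def)
    qed
    show "actKi V (node r (s \<noteq> 1) i) = (\<chi> x y. if x = y then inverse (kval q i (pos x)) else 0)"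
    proof -
      let ?X = "\<chi> x y. if x = y then inverse (kval q i (pos x)) else 0 :: complex^'n^'n"
      have "(?X *v (K i *v axis y 1)) $ x = axis y 1 $ x" for x y
      proof -
        have "kval q i (pos y) \<noteq> 0" using q by (simp add: kval_def)
        then show ?thesis
          unfolding K_def n_def Km matrix_axis
          by (simp add: matrix_vector_mult_def axis_def if_distrib[of "\<lambda>x. _ * x"] cong: if_cong)
      qed
      then have XK: "?X ** K i = mat 1"
        by (intro matrix_eq_on_axes) (simp add: vec_eq_iff flip: matrix_vector_mul_assoc)
      have "Ki i = (?X ** K i) ** Ki i" unfolding XK by simp
      also have "\<dots> = ?X" using inv(1)[OF i] by (simp flip: matrix_mul_assoc)
      finally have "Ki i = ?X" .
      then show ?thesis by (simp add: Ki_def n_def)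
    qed
    have E_axis: "E i *v axis (b k) 1 = (if i = k then c k *s axis (b (k - 1)) 1 else 0)" if k:
        "k \<le> r" for k
    proof -
      have "E i *v u k = (if i = k then u (k - 1) else 0)" using good[OF k] i
          by (simp add: good_def)
      moreover have "u (k - 1) = t (k - 1) *s axis (b (k - 1)) 1" using u_axis[of "k - 1"] k by simp
      ultimately show ?thesis by (simp add: axis_u[OF k] vector_scalar_commute c_def)
    qed
    have F_axis: "F i *v axis (b k) 1 = (if i = k + 1 then inverse (c i) *s axis (b i) 1
        else 0)" if k: "k \<le> r" for k
    proof -
      have "F i *v u k = (if i = k + 1 then u (k + 1) else 0)"
        using good[OF k] i by (simp add: good_def uS)
      moreover have "u i = t i *s axis (b i) 1" using u_axis[of i] i by simp
      ultimately show ?thesis by (auto simp: axis_u[OF k] vector_scalar_commute c_def)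
    qed
    have "E i $ x $ y = (if pos x = i \<and> pos y = i + 1 then c i else 0)" for x y
    proof -
      have "E i $ x $ y = (E i *v axis (b (pos y - 1)) 1) $ x" by (rule col)
      also have "\<dots> = (if i = pos y - 1 \<and> x = b (i - 1) then c i else 0)"
        unfolding E_axis[OF b_pos(2)] by (auto simp: axis_def)
      also have "x = b (i - 1) \<longleftrightarrow> pos x = i" using b_eq[of "i - 1" x] i by auto
      also have "i = pos y - 1 \<longleftrightarrow> pos y = i + 1" using b_pos(3)[of y] by auto
      finally show ?thesis by (simp add: conj_commute)
    qed
    then show "actE V (node r (s \<noteq> 1) i) = (\<chi> x y. if pos x = i \<and> pos y = i + 1 then c i else 0)"
      by (simp add: vec_eq_iff E_def n_def)
    have "F i $ x $ y = (if pos x = i + 1 \<and> pos y = i then inverse (c i) else 0)" for x y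
    proof -
      have "F i $ x $ y = (F i *v axis (b (pos y - 1)) 1) $ x" by (rule col)
      also have "\<dots> = (if i = pos y - 1 + 1 \<and> x = b i then inverse (c i) else 0)"
        unfolding F_axis[OF b_pos(2)] by (auto simp: axis_def)
      also have "x = b i \<longleftrightarrow> pos x = i + 1" using b_eq[of i x] i by auto
      also have "i = pos y - 1 + 1 \<longleftrightarrow> pos y = i" using b_pos(3)[of y] by auto
      finally show ?thesis by (simp add: conj_commute)
    qed
    then show "actF V (node r (s \<noteq> 1) i) =
        (\<chi> x y. if pos x = i + 1 \<and> pos y = i then inverse (c i) else 0)"
      by (simp add: vec_eq_iff F_def n_def)
  qed
  then show ?thesis by (rule that)
qed

section \<open>Intertwiners are determined by one value\<close>

lemma kron_vec_tensor:
  fixes A :: "complex^'x::finite^'x" and B :: "complex^'y::finite^'y"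
  shows "kron A B *v vec_tensor v u = vec_tensor (A *v v) (B *v u)"
proof -
  have "(\<Sum>z\<in>UNIV. A $ a $ fst z * B $ b $ snd z * (v $ fst z * u $ snd z)) =
      (\<Sum>x\<in>UNIV. A $ a $ x * v $ x) * (\<Sum>y\<in>UNIV. B $ b $ y * u $ y)" for a b
    unfolding sum_product sum.cartesian_product
    by (rule sum.cong) (simp_all add: case_prod_unfold mult_ac)
  then show ?thesis
    by (simp add: kron_def vec_tensor_def matrix_vector_mult_def vec_eq_iff)
qed

lemma vec_tensor_axis: "vec_tensor (axis a 1) (axis b 1) = axis (a, b) 1"
  by (auto simp: vec_tensor_def vec_eq_iff axis_def)

lemma vec_tensor_linear:
  "vec_tensor (v + v') u = vec_tensor v u + vec_tensor v' u"
  "vec_tensor v (u + u') = vec_tensor v u + vec_tensor v u'"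
  "vec_tensor (z *s v) u = z *s vec_tensor v u"
  "vec_tensor v (z *s u) = z *s vec_tensor v u"
  "vec_tensor (- v) u = - vec_tensor v u" "vec_tensor v (- u) = - vec_tensor v u"
  "vec_tensor 0 u = 0" "vec_tensor v 0 = 0"
  by (simp_all add: vec_tensor_def vec_eq_iff algebra_simps)

lemma tensor_rep_act:
  fixes X :: "'x::finite uq_rep" and Y :: "'y::finite uq_rep"
  shows "actK (tensor_rep X Y) i *v vec_tensor v u = vec_tensor (actK X i *v v) (actK Y i *v u)"
    and "actKi (tensor_rep X Y) i *v vec_tensor v u = vec_tensor (actKi X i *v v) (actKi Y i *v u)"
    and "actE (tensor_rep X Y) i *v vec_tensor v u =
      vec_tensor (actE X i *v v) (actK Y i *v u) + vec_tensor v (actE Y i *v u)"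
    and "actF (tensor_rep X Y) i *v vec_tensor v u =
      vec_tensor (actF X i *v v) u + vec_tensor (actKi X i *v v) (actF Y i *v u)"
  by (simp_all add: tensor_rep_def matrix_vector_mult_add_rdistrib kron_vec_tensor)

text \<open>
  The vectors on which two intertwiners agree form a submodule.  From $e_1 \otimes y$ it contains
  $e_1 \otimes E_i y$, because $E_i e_1 = 0$; so it contains $e_1 \otimes Y$.  From $e_k \otimes Y$ it
  then reaches $F_i e_k \otimes Y$, because the second term of $\Delta(F_i)$ stays in
  $e_k \otimes Y$.
\<close>

lemma intertwiner_unique:
  fixes R1 R2 :: "complex^('n::finite \<times> 'm::finite)^('z::finite)"
  assumes X: "vector_rep r q flipX posX cX (X :: ('n::finite) uq_rep)"
    and Y: "vector_rep r q flipY posY cY (Y :: ('m::finite) uq_rep)"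
    and R1: "intertwines r (tensor_rep X Y) Z R1" and R2: "intertwines r (tensor_rep X Y) Z R2"
    and agree: "R1 *v vec_tensor (vector_rep.e posX 1) (vector_rep.e posY (r + 1)) =
      R2 *v vec_tensor (vector_rep.e posX 1) (vector_rep.e posY (r + 1))"
  shows "R1 = R2"
proof -
  interpret X: vector_rep r q flipX posX cX X by (rule X)
  interpret Y: vector_rep r q flipY posY cY Y by (rule Y)
  define W where "W = {z. R1 *v z = R2 *v z}"
  have add: "x + y \<in> W" if "x \<in> W" "y \<in> W" for x y
    using that by (simp add: W_def matrix_vector_right_distrib)
  have diff: "x \<in> W" if "x + y \<in> W" "y \<in> W" for x y
    using that by (simp add: W_def matrix_vector_right_distrib)
  have scale: "d *s x \<in> W" if "x \<in> W" for d x
    using that by (simp add: W_def vector_scalar_commute)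
  have descale: "x \<in> W" if "d *s x \<in> W" "d \<noteq> 0" for d x
    using that by (simp add: W_def vector_scalar_commute)
  have E: "actE (tensor_rep X Y) i *v z \<in> W" and F: "actF (tensor_rep X Y) i *v z \<in> W"
    if "z \<in> W" "i \<in> {1..r}" for z i
  proof -
    have *: "A *v z \<in> W" if "R1 ** A = B ** R1" "R2 ** A = B ** R2" for A B
    proof -
      have "R1 *v (A *v z) = B *v (R1 *v z)" "R2 *v (A *v z) = B *v (R2 *v z)"
        by (simp_all only: matrix_vector_mul_assoc that)
      then show ?thesis using \<open>z \<in> W\<close> by (simp add: W_def)
    qed
    show "actE (tensor_rep X Y) i *v z \<in> W" "actF (tensor_rep X Y) i *v z \<in> W"
      using R1 R2 that(2) by (auto simp: intertwines_def intro: *)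
  qed
  have first: "vec_tensor (X.e 1) (Y.e l) \<in> W" if "l \<le> r + 1" "1 \<le> l" for l
    using that
  proof (induction rule: inc_induct)
    case base
    show ?case using agree by (simp add: W_def)
  next
    case (step n)
    define i where "i = node r flipY n"
    have n: "n \<in> {1..r}" and i: "i \<in> {1..r}" using step node_in[of n r flipY] by (auto simp: i_def)
    have "vec_tensor (X.e 1) (Y.e (Suc n)) \<in> W" using step by simp
    from E[OF this i] have "vec_tensor (actE X i *v X.e 1) (actK Y i *v Y.e (Suc n)) +
        vec_tensor (X.e 1) (actE Y i *v Y.e (Suc n)) \<in> W"
      by (simp add: tensor_rep_act)
    moreover have "actE X i *v X.e 1 = 0"
      using X.highest_weight_e i by (simp add: highest_weight_vector_def)
    moreover have "actE Y i *v Y.e (Suc n) = cY n *s Y.e n"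
      using Y.E_e[of n "Suc n"] n by (simp add: i_def)
    ultimately have "cY n *s vec_tensor (X.e 1) (Y.e n) \<in> W" by (simp add: vec_tensor_linear)
    then show ?case using Y.c_nonzero[OF n] descale by blast
  qed
  have all: "\<forall>l\<in>{1..r+1}. vec_tensor (X.e k) (Y.e l) \<in> W" if "1 \<le> k" "k \<le> r + 1" for k
    using that
  proof (induction rule: dec_induct)
    case base
    then show ?case using first by auto
  next
    case (step n)
    define i where "i = node r flipX n"
    have n: "n \<in> {1..r}" and i: "i \<in> {1..r}" using step node_in[of n r flipX] by (auto simp: i_def)
    show ?case
    proof
      fix l assume l: "l \<in> {1..r+1}"
      have IH: "vec_tensor (X.e n) (Y.e l) \<in> W" if "l \<in> {1..r+1}" for l using step that by auto
      have KX: "actKi X i *v X.e n = inverse (kval q n n) *s X.e n"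
        using X.Ki_e[of n n] n by (simp add: i_def)
      have FX: "actF X i *v X.e n = inverse (cX n) *s X.e (Suc n)"
        using X.F_e[of n n] n by (simp add: i_def)
      obtain j where j: "j \<in> {1..r}" "i = node r flipY j"
        using node_node[OF i, of flipY] node_in[OF i, of flipY] by metis
      have "vec_tensor (X.e n) (actF Y i *v Y.e l) \<in> W"
      proof (cases "l = j")
        case True
        then have "actF Y i *v Y.e l = inverse (cY j) *s Y.e (j + 1)"
          using Y.F_e[OF j(1) l] j(2) by simp
        moreover have "vec_tensor (X.e n) (Y.e (j + 1)) \<in> W" using j(1) by (intro IH) auto
        ultimately show ?thesis by (simp only: vec_tensor_linear scale)
      next
        case False
        then have "actF Y i *v Y.e l = 0" using Y.F_e[OF j(1) l] j(2) by simp
        then show ?thesis by (simp add: vec_tensor_linear W_def)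
      qed
      then have "vec_tensor (actKi X i *v X.e n) (actF Y i *v Y.e l) \<in> W"
        unfolding KX vec_tensor_linear by (rule scale)
      moreover have "vec_tensor (actF X i *v X.e n) (Y.e l) +
          vec_tensor (actKi X i *v X.e n) (actF Y i *v Y.e l) \<in> W"
        using F[OF IH[OF l] i] by (simp add: tensor_rep_act)
      ultimately have "vec_tensor (actF X i *v X.e n) (Y.e l) \<in> W" by (rule diff[rotated])
      then show "vec_tensor (X.e (Suc n)) (Y.e l) \<in> W"
        unfolding FX vec_tensor_linear using X.c_nonzero[OF n] descale by simp
    qed
  qed
  show ?thesis
  proof (rule matrix_eq_on_axes)
    fix z :: "'n \<times> 'm"
    have "axis z 1 = vec_tensor (X.e (posX (fst z))) (Y.e (posY (snd z)))"
      by (simp add: vec_tensor_axis flip: X.axis_eq_e Y.axis_eq_e)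
    then show "R1 *v axis z 1 = R2 *v axis z 1"
      using all[of "posX (fst z)"] X.pos_in[of "fst z"] Y.pos_in[of "snd z"] by (auto simp: W_def)
  qed
qed

section \<open>The braidings in coordinates\<close>

text \<open>
  The standard Hecke type solution of the braid equation.  For $k < l$ it maps $e_k \otimes e_l$ to
  $h\, e_l \otimes e_k$ and $e_l \otimes e_k$ to
  $h (e_k \otimes e_l + (q - q^{-1})\, e_l \otimes e_k)$.  Rescaling the basis vectors does not change
  the matrix, so it depends on the order of the basis only.
\<close>

definition braid :: "real \<Rightarrow> complex \<Rightarrow> ('n::finite \<Rightarrow> nat) \<Rightarrow> complex^('n \<times> 'n)^('n \<times> 'n)" where
  "braid q h pos = (\<chi> x y. h * (
     (if x = prod.swap y then if fst y = snd y then complex_of_real q else 1 else 0) +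
     (if x = y \<and> pos (snd y) < pos (fst y) then complex_of_real q - inverse (complex_of_real q)
         else 0)))"

definition braid_inv :: "real \<Rightarrow> complex \<Rightarrow> ('n::finite \<Rightarrow> nat) \<Rightarrow> complex^('n \<times> 'n)^('n \<times> 'n)" where
  "braid_inv q h pos = (\<chi> x y. inverse h * (
     (if x = prod.swap y then if fst y = snd y then inverse (complex_of_real q) else 1 else 0) -
     (if x = y \<and> pos (fst y) < pos (snd y) then complex_of_real q - inverse (complex_of_real q)
         else 0)))"

text \<open>
  The partial transpose of the inverse braiding, with powers of $q$ coming from $E'$.  This formula is
  the naturality $E'_{12} D_{23} = E'_{23} R_{12}^{-1}$ solved for $D$.
\<close>

definition braid_dual :: "real \<Rightarrow> complex \<Rightarrow> ('n::finite \<Rightarrow> nat) \<Rightarrow> complex^('n \<times> 'n)^('n \<times> 'n)" where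
  "braid_dual q h pos = (\<chi> x y. complex_of_real q ^ (2 * pos (fst x)) / complex_of_real q ^
      (2 * pos (snd y)) *
     braid_inv q h pos $ (snd x, snd y) $ (fst x, fst y))"

lemma braid_hecke:
  assumes "h \<noteq> 0" "inj pos"
  shows "braid q h pos $ x $ y = h\<^sup>2 * braid_inv q h pos $ x $ y +
    (if x = y then h * (complex_of_real q - inverse (complex_of_real q)) else 0)"
proof -
  have cancel: "h\<^sup>2 * (inverse h * t) = h * t" for t
    using assms(1) by (simp add: power2_eq_square)
  consider "pos (fst y) < pos (snd y)" "fst y \<noteq> snd y" | "pos (snd y) < pos (fst y)" "fst y \<noteq> snd y"
    | "fst y = snd y" using assms(2) by (metis injD linorder_less_linear)
  then show ?thesis
  proof cases
    case 3
    then have "prod.swap y = y" by (cases y) simp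
    then show ?thesis using 3
      unfolding braid_def braid_inv_def vec_lambda_beta cancel by (auto simp: algebra_simps)
  next
    case 1
    then have "prod.swap y \<noteq> y" by (cases y) auto
    then show ?thesis using 1
      unfolding braid_def braid_inv_def vec_lambda_beta cancel by (auto simp: algebra_simps)
  next
    case 2
    then have "prod.swap y \<noteq> y" by (cases y) auto
    then show ?thesis using 2
      unfolding braid_def braid_inv_def vec_lambda_beta cancel by (auto simp: algebra_simps)
  qed
qed

context vector_rep
begin

definition ee :: "nat \<Rightarrow> nat \<Rightarrow> complex^('n \<times> 'n)" where
  "ee k l = vec_tensor (e k) (e l)"

lemma inj_pos: "inj pos" using pos_bij by (simp add: bij_betw_def)

lemma idx_inject: "k \<in> {1..r+1} \<Longrightarrow> l \<in> {1..r+1} \<Longrightarrow> idx k = idx l \<longleftrightarrow> k = l"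
  by (metis pos_idx)

lemma matrix_eq_on_ee:
  fixes A B :: "complex^('n \<times> 'n)^'m::finite"
  assumes "\<And>k l. k \<in> {1..r+1} \<Longrightarrow> l \<in> {1..r+1} \<Longrightarrow> A *v ee k l = B *v ee k l"
  shows "A = B"
proof (rule matrix_eq_on_axes)
  fix z :: "'n \<times> 'n"
  have "axis z 1 = ee (pos (fst z)) (pos (snd z))"
    by (simp add: ee_def vec_tensor_axis flip: axis_eq_e)
  then show "A *v axis z 1 = B *v axis z 1" using assms pos_in by simp
qed

lemma ee_axis: "ee k l = axis (idx k, idx l) 1"
  by (simp add: ee_def e_def vec_tensor_axis)

lemma braid_ee:
  assumes "k \<in> {1..r+1}" "l \<in> {1..r+1}"
  shows "braid q h pos *v ee k l = (if k = l then (h * complex_of_real q) *s ee k k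
    else if k < l then h *s ee l k
    else h *s ee l k + (h * (complex_of_real q - inverse (complex_of_real q))) *s ee k l)"
  unfolding ee_axis matrix_axis using assms idx_inject[OF assms]
  by (auto simp: braid_def vec_eq_iff axis_def)

lemma braid_inv_ee:
  assumes "k \<in> {1..r+1}" "l \<in> {1..r+1}"
  shows "braid_inv q h pos *v ee k l = (if k = l then (inverse h * inverse (complex_of_real q)) *s
      ee k k
    else if l < k then inverse h *s ee l k
    else inverse h *s ee l k - (inverse h * (complex_of_real q - inverse (complex_of_real q))) *s
        ee k l)"
  unfolding ee_axis matrix_axis using assms idx_inject[OF assms]
  by (auto simp: braid_inv_def vec_eq_iff axis_def algebra_simps)

lemma braid_inv_braid:
  assumes "h \<noteq> 0"
  shows "braid_inv q h pos ** braid q h pos = mat 1"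
proof (rule matrix_eq_on_ee)
  fix k l assume kl: "k \<in> {1..r+1}" "l \<in> {1..r+1}"
  define z where "z = complex_of_real q - inverse (complex_of_real q)"
  have "complex_of_real q \<noteq> 0" using q_pos by simp
  then show "(braid_inv q h pos ** braid q h pos) *v ee k l = mat 1 *v ee k l"
    using kl assms
    by (auto simp: matrix_vector_mul_assoc[symmetric] braid_ee braid_inv_ee vector_scalar_commute
        matrix_vector_right_distrib vec_eq_iff z_def[symmetric] algebra_simps)
qed

lemma intertwines_on_ee:
  fixes X Y N P :: "'n uq_rep"
  assumes "\<And>i k l. i \<in> {1..r} \<Longrightarrow> k \<in> {1..r+1} \<Longrightarrow> l \<in> {1..r+1} \<Longrightarrow>
      R *v (actK (tensor_rep X Y) (node r flip i) *v ee k l) =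
          actK (tensor_rep N P) (node r flip i) *v (R *v ee k l)"
    and "\<And>i k l. i \<in> {1..r} \<Longrightarrow> k \<in> {1..r+1} \<Longrightarrow> l \<in> {1..r+1} \<Longrightarrow>
      R *v (actKi (tensor_rep X Y) (node r flip i) *v ee k l) =
          actKi (tensor_rep N P) (node r flip i) *v (R *v ee k l)"
    and "\<And>i k l. i \<in> {1..r} \<Longrightarrow> k \<in> {1..r+1} \<Longrightarrow> l \<in> {1..r+1} \<Longrightarrow>
      R *v (actE (tensor_rep X Y) (node r flip i) *v ee k l) =
          actE (tensor_rep N P) (node r flip i) *v (R *v ee k l)"
    and "\<And>i k l. i \<in> {1..r} \<Longrightarrow> k \<in> {1..r+1} \<Longrightarrow> l \<in> {1..r+1} \<Longrightarrow>
      R *v (actF (tensor_rep X Y) (node r flip i) *v ee k l) =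
          actF (tensor_rep N P) (node r flip i) *v (R *v ee k l)"
  shows "intertwines r (tensor_rep X Y) (tensor_rep N P) R"
  unfolding intertwines_def
  by (intro ball_nodeI[where flip = flip] conjI; rule matrix_eq_on_ee)
    (simp_all only: assms matrix_vector_mul_assoc[symmetric])

lemma tensor_act_ee:
  assumes "i \<in> {1..r}" "k \<in> {1..r+1}" "l \<in> {1..r+1}"
  shows "actK (tensor_rep M M) (node r flip i) *v ee k l = (kval q i k * kval q i l) *s ee k l"
    and "actKi (tensor_rep M M) (node r flip i) *v ee k l =
        (inverse (kval q i k) * inverse (kval q i l)) *s ee k l"
    and "actE (tensor_rep M M) (node r flip i) *v ee k l =
      (if k = i + 1 then (c i * kval q i l) *s ee i l else 0) + (if l = i + 1 then c i *s ee k i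
          else 0)"
    and "actF (tensor_rep M M) (node r flip i) *v ee k l =
      (if k = i then inverse (c i) *s ee (i + 1) l else 0) +
      (if l = i then (inverse (c i) * inverse (kval q i k)) *s ee k (i + 1) else 0)"
  using assms by (simp_all add: ee_def tensor_rep_act act_e vec_tensor_linear mult.commute)

lemma braid_intertwines: "intertwines r (tensor_rep M M) (tensor_rep M M) (braid q h pos)"
proof (rule intertwines_on_ee)
  fix i k l assume ikl: "i \<in> {1..r}" "k \<in> {1..r+1}" "l \<in> {1..r+1}"
  then have i1: "i \<in> {1..r+1}" "i + 1 \<in> {1..r+1}" by auto
  have Q: "complex_of_real q \<noteq> 0" using q_pos by simp
  note lin = vector_scalar_commute matrix_vector_right_distrib
  show "braid q h pos *v (actK (tensor_rep M M) (node r flip i) *v ee k l) =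
      actK (tensor_rep M M) (node r flip i) *v (braid q h pos *v ee k l)"
    using ikl by (simp add: tensor_act_ee(1) braid_ee lin vec_eq_iff algebra_simps)
  show "braid q h pos *v (actKi (tensor_rep M M) (node r flip i) *v ee k l) =
      actKi (tensor_rep M M) (node r flip i) *v (braid q h pos *v ee k l)"
    using ikl by (simp add: tensor_act_ee(2) braid_ee lin vec_eq_iff algebra_simps)
  show "braid q h pos *v (actE (tensor_rep M M) (node r flip i) *v ee k l) =
      actE (tensor_rep M M) (node r flip i) *v (braid q h pos *v ee k l)"
    using Q ikl by (cases "k = i + 1"; cases "l = i + 1"; cases "k = i"; cases "l = i")
      (auto simp add: tensor_act_ee(3) braid_ee lin kval_def vec_eq_iff algebra_simps)
  show "braid q h pos *v (actF (tensor_rep M M) (node r flip i) *v ee k l) =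
      actF (tensor_rep M M) (node r flip i) *v (braid q h pos *v ee k l)"
    using Q ikl by (cases "k = i + 1"; cases "l = i + 1"; cases "k = i"; cases "l = i")
      (auto simp add: tensor_act_ee(4) braid_ee lin kval_def vec_eq_iff algebra_simps)
qed

lemma dual_e:
  assumes "k \<in> {1..r+1}"
  shows "vector_rep.e (\<lambda>x. r + 2 - pos x) (r + 2 - k) = e k"
proof -
  interpret D: vector_rep r q "\<not> flip" "\<lambda>x. r + 2 - pos x"
      "\<lambda>i. - complex_of_real q * c (r + 1 - i)" "dual_rep M"
    by (rule dual)
  have "D.e (r + 2 - pos (idx k)) = axis (idx k) 1" using D.axis_eq_e[of "idx k"] by simp
  then show ?thesis using assms by (simp add: e_def)
qed

lemma dual_act_e:
  assumes i: "i \<in> {1..r}" and k: "k \<in> {1..r+1}"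
  shows "actK (dual_rep M) (node r flip i) *v e k = inverse (kval q i k) *s e k"
    and "actKi (dual_rep M) (node r flip i) *v e k = kval q i k *s e k"
    and "actE (dual_rep M) (node r flip i) *v e k =
        (if k = i then (- complex_of_real q * c i) *s e (i + 1) else 0)"
    and "actF (dual_rep M) (node r flip i) *v e k =
      (if k = i + 1 then (- inverse (complex_of_real q) * inverse (c i)) *s e i else 0)"
proof -
  interpret D: vector_rep r q "\<not> flip" "\<lambda>x. r + 2 - pos x"
      "\<lambda>i. - complex_of_real q * c (r + 1 - i)" "dual_rep M"
    by (rule dual)
  define j where "j = r + 1 - i"
  have j: "j \<in> {1..r}" and n: "node r (\<not> flip) j = node r flip i" and ji: "r + 1 - j = i"
    using i by (auto simp: j_def node_def)
  define l where "l = r + 2 - k"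
  have l: "l \<in> {1..r+1}" and el: "D.e l = e k" using k dual_e[OF k] by (auto simp: l_def)
  have ej: "D.e j = e (i + 1)" and ej1: "D.e (j + 1) = e i"
    using i dual_e[of "i + 1"] dual_e[of i] by (auto simp: j_def Suc_diff_le)
  have lj: "l = j \<longleftrightarrow> k = i + 1" "l = j + 1 \<longleftrightarrow> k = i" using i k by (auto simp: l_def j_def)
  have kv: "kval q j l = inverse (kval q i k)" unfolding kval_def lj by auto
  show "actK (dual_rep M) (node r flip i) *v e k = inverse (kval q i k) *s e k"
    "actKi (dual_rep M) (node r flip i) *v e k = kval q i k *s e k"
    using D.K_e[OF j l] D.Ki_e[OF j l] unfolding n el kv by simp_all
  show "actE (dual_rep M) (node r flip i) *v e k =
      (if k = i then (- complex_of_real q * c i) *s e (i + 1) else 0)"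
    using D.E_e[OF j l] unfolding n el lj ej ji .
  show "actF (dual_rep M) (node r flip i) *v e k =
      (if k = i + 1 then (- inverse (complex_of_real q) * inverse (c i)) *s e i else 0)"
    using D.F_e[OF j l] unfolding n el lj ej1 ji by simp
qed

text \<open>
  The part of $\sum_j q^{2j} f^j \otimes e_j$ below $k$; the full sum spans the invariants of
  $V^* \otimes V$, so the action of $E_i$ and $F_i$ on the truncated one leaves at most a boundary
  term.
\<close>

definition diag_sum :: "nat \<Rightarrow> complex^('n \<times> 'n)" where
  "diag_sum k = (\<Sum>j=1..<k. complex_of_real q ^ (2 * j) *s ee j j)"

lemma braid_dual_ee:
  assumes "k \<in> {1..r+1}" "l \<in> {1..r+1}"
  shows "braid_dual q h pos *v ee k l = (if k = l
    then inverse h *s (inverse (complex_of_real q) *s ee k k -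
      ((complex_of_real q - inverse (complex_of_real q)) / complex_of_real q ^ (2 * k)) *s
          diag_sum k)
    else inverse h *s ee l k)"
proof (cases "k = l")
  case False
  then have "idx k \<noteq> idx l" using assms by (simp add: idx_inject)
  then show ?thesis
    unfolding ee_axis matrix_axis using assms False q_pos
    by (auto simp: braid_dual_def braid_inv_def vec_eq_iff axis_def)
next
  case True
  have ds: "diag_sum k $ (x, y) = (if x = y \<and> pos x < k then complex_of_real q ^ (2 * pos x)
      else 0)" for x y
  proof -
    have "diag_sum k $ (x, y) = (\<Sum>j=1..<k. if j = pos x then if x = y
        then complex_of_real q ^ (2 * j) else 0 else 0)"
      unfolding diag_sum_def sum_component
      by (rule sum.cong) (use assms in \<open>auto simp: ee_axis axis_def idx_eq_iff dest:
          injD[OF inj_pos]\<close>)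
    also have "\<dots> = (if x = y \<and> pos x < k then complex_of_real q ^ (2 * pos x) else 0)"
      using pos_in[of x] by auto
    finally show ?thesis .
  qed
  have "(braid_dual q h pos *v ee k k) $ (x, y) =
      (inverse h *s (inverse (complex_of_real q) *s ee k k -
      ((complex_of_real q - inverse (complex_of_real q)) / complex_of_real q ^ (2 * k)) *s
          diag_sum k)) $ (x, y)" for x y
  proof -
    have pos_eq: "pos a = pos b \<longleftrightarrow> a = b" for a b using inj_pos by (auto dest: injD)
    have lhs: "(braid_dual q h pos *v ee k k) $ (x, y) =
        complex_of_real q ^ (2 * pos x) / complex_of_real q ^ (2 * k) *
        (inverse h * ((if x = idx k \<and> y = idx k then inverse (complex_of_real q) else 0)
          - (if x = y \<and> pos x < k then complex_of_real q - inverse (complex_of_real q) else 0)))"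
      unfolding ee_axis matrix_axis using assms(1)
      by (auto simp: braid_dual_def braid_inv_def)
    have "ee k k $ (x, y) = (if x = idx k \<and> y = idx k then 1 else 0)"
      by (auto simp: ee_axis axis_def)
    then show ?thesis unfolding lhs using assms(1) q_pos
      by (auto simp: ds)
  qed
  then show ?thesis using True by (simp add: vec_eq_iff)
qed

lemma tensor_dual_act_ee:
  assumes "i \<in> {1..r}" "k \<in> {1..r+1}" "l \<in> {1..r+1}"
  shows "actK (tensor_rep M (dual_rep M)) (node r flip i) *v ee k l =
      (kval q i k * inverse (kval q i l)) *s ee k l"
    and "actKi (tensor_rep M (dual_rep M)) (node r flip i) *v ee k l =
        (inverse (kval q i k) * kval q i l) *s ee k l"
    and "actE (tensor_rep M (dual_rep M)) (node r flip i) *v ee k l =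
      (if k = i + 1 then (c i * inverse (kval q i l)) *s ee i l else 0) +
      (if l = i then (- complex_of_real q * c i) *s ee k (i + 1) else 0)"
    and "actF (tensor_rep M (dual_rep M)) (node r flip i) *v ee k l =
      (if k = i then inverse (c i) *s ee (i + 1) l else 0) +
      (if l = i + 1 then (- inverse (complex_of_real q) * inverse (c i) * inverse (kval q i k)) *s
          ee k i else 0)"
  using assms by (simp_all add: ee_def tensor_rep_act act_e dual_act_e vec_tensor_linear
      mult.commute)

lemma dual_tensor_act_ee:
  assumes "i \<in> {1..r}" "k \<in> {1..r+1}" "l \<in> {1..r+1}"
  shows "actK (tensor_rep (dual_rep M) M) (node r flip i) *v ee l k =
      (kval q i k * inverse (kval q i l)) *s ee l k"
    and "actKi (tensor_rep (dual_rep M) M) (node r flip i) *v ee l k =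
        (inverse (kval q i k) * kval q i l) *s ee l k"
    and "actE (tensor_rep (dual_rep M) M) (node r flip i) *v ee l k =
      (if l = i then (- complex_of_real q * c i * kval q i k) *s ee (i + 1) k else 0) +
      (if k = i + 1 then c i *s ee l i else 0)"
    and "actF (tensor_rep (dual_rep M) M) (node r flip i) *v ee l k =
      (if l = i + 1 then (- inverse (complex_of_real q) * inverse (c i)) *s ee i k else 0) +
      (if k = i then (inverse (c i) * kval q i l) *s ee l (i + 1) else 0)"
  using assms by (simp_all add: ee_def tensor_rep_act act_e dual_act_e vec_tensor_linear
      mult.commute)

lemma act_diag_sum:
  assumes i: "i \<in> {1..r}" and k: "1 \<le> k" "k \<le> r + 1"
  shows "actK (tensor_rep (dual_rep M) M) (node r flip i) *v diag_sum k = diag_sum k"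
    and "actKi (tensor_rep (dual_rep M) M) (node r flip i) *v diag_sum k = diag_sum k"
    and "actE (tensor_rep (dual_rep M) M) (node r flip i) *v diag_sum k =
      (if k = i + 1 then (- (complex_of_real q ^ (2 * k)) * c i) *s ee (i + 1) i else 0)"
    and "actF (tensor_rep (dual_rep M) M) (node r flip i) *v diag_sum k =
      (if k = i + 1 then (complex_of_real q ^ (2 * k) * inverse (complex_of_real q) * inverse
          (c i)) *s ee i (i + 1) else 0)"
proof -
  have Q: "complex_of_real q \<noteq> 0" using q_pos by simp
  have one: "diag_sum 1 = 0" by (simp add: diag_sum_def)
  have Suc: "diag_sum (Suc n) = diag_sum n + complex_of_real q ^ (2 * n) *s ee n n" if "1 \<le> n" for n
    using that by (simp add: diag_sum_def)
  note lin = vector_scalar_commute matrix_vector_right_distrib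
  show "actK (tensor_rep (dual_rep M) M) (node r flip i) *v diag_sum k = diag_sum k"
    using k
  proof (induction k rule: dec_induct)
    case (step n)
    then show ?case using i by (simp add: Suc lin dual_tensor_act_ee)
  qed (use one in simp)
  show "actKi (tensor_rep (dual_rep M) M) (node r flip i) *v diag_sum k = diag_sum k"
    using k
  proof (induction k rule: dec_induct)
    case (step n)
    then show ?case using i by (simp add: Suc lin dual_tensor_act_ee)
  qed (use one in simp)
  show "actE (tensor_rep (dual_rep M) M) (node r flip i) *v diag_sum k =
      (if k = i + 1 then (- (complex_of_real q ^ (2 * k)) * c i) *s ee (i + 1) i else 0)"
    using k
  proof (induction k rule: dec_induct)
    case (step n)
    then show ?case using i Q
      by (auto simp: Suc lin dual_tensor_act_ee kval_def vec_eq_iff power2_eq_square algebra_simps)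
  qed (use one i in auto)
  show "actF (tensor_rep (dual_rep M) M) (node r flip i) *v diag_sum k =
      (if k = i + 1 then (complex_of_real q ^ (2 * k) * inverse (complex_of_real q) * inverse
          (c i)) *s ee i (i + 1) else 0)"
    using k
  proof (induction k rule: dec_induct)
    case (step n)
    then show ?case using i Q
      by (auto simp: Suc lin dual_tensor_act_ee kval_def vec_eq_iff power2_eq_square algebra_simps)
  qed (use one i in auto)
qed

lemma braid_dual_intertwines:
  "intertwines r (tensor_rep M (dual_rep M)) (tensor_rep (dual_rep M) M) (braid_dual q h pos)"
proof (rule intertwines_on_ee)
  fix i k l assume ikl: "i \<in> {1..r}" "k \<in> {1..r+1}" "l \<in> {1..r+1}"
  define Q where "Q = complex_of_real q"
  have Q: "Q \<noteq> 0" using q_pos by (simp add: Q_def)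
  define H where "H = inverse h"
  have lin: "A *v (z *s x) = z *s (A *v x)" "A *v (x + y) = A *v x + A *v y" "A *v (x - y) =
      A *v x - A *v y"
    "A *v (- x) = - (A *v x)" for A :: "complex^('n \<times> 'n)^('n \<times> 'n)" and z x y
    by (simp_all add: vector_scalar_commute matrix_vector_right_distrib
        matrix_vector_mult_diff_distrib)
      (simp add: vec_eq_iff matrix_vector_mult_def sum_negf)
  show "braid_dual q h pos *v (actK (tensor_rep M (dual_rep M)) (node r flip i) *v ee k l) =
      actK (tensor_rep (dual_rep M) M) (node r flip i) *v (braid_dual q h pos *v ee k l)"
    using ikl by (simp add: tensor_dual_act_ee(1) dual_tensor_act_ee(1) act_diag_sum(1)
        braid_dual_ee lin vec_eq_iff)
  show "braid_dual q h pos *v (actKi (tensor_rep M (dual_rep M)) (node r flip i) *v ee k l) =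
      actKi (tensor_rep (dual_rep M) M) (node r flip i) *v (braid_dual q h pos *v ee k l)"
    using ikl by (simp add: tensor_dual_act_ee(2) dual_tensor_act_ee(2) act_diag_sum(2)
        braid_dual_ee lin vec_eq_iff)
  have ds: "diag_sum (i + 1) = diag_sum i + Q ^ (2 * i) *s ee i i"
    using ikl by (simp add: diag_sum_def Q_def)
  show "braid_dual q h pos *v (actE (tensor_rep M (dual_rep M)) (node r flip i) *v ee k l) =
      actE (tensor_rep (dual_rep M) M) (node r flip i) *v (braid_dual q h pos *v ee k l)"
    using ikl Q by (cases "k = i + 1"; cases "l = i";
      auto simp: tensor_dual_act_ee(3) dual_tensor_act_ee(3) act_diag_sum(3) braid_dual_ee lin
          kval_def
        ds[simplified] vec_eq_iff power2_eq_square Q_def[symmetric] H_def[symmetric] algebra_simps;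
        (simp add: field_simps)?)
  show "braid_dual q h pos *v (actF (tensor_rep M (dual_rep M)) (node r flip i) *v ee k l) =
      actF (tensor_rep (dual_rep M) M) (node r flip i) *v (braid_dual q h pos *v ee k l)"
    using ikl Q by (cases "l = i + 1"; cases "k = i";
      auto simp: tensor_dual_act_ee(4) dual_tensor_act_ee(4) act_diag_sum(4) braid_dual_ee lin
          kval_def
        ds[simplified] vec_eq_iff power2_eq_square Q_def[symmetric] H_def[symmetric] algebra_simps;
        (simp add: field_simps)?)
qed

text \<open>
  The normalisation is $h = q^{(\omega_s, w_0 \omega_s)} = q^{-1/(r+1)}$, since
  $e_1 \otimes e_{r+1}$ is a highest weight vector times a lowest weight vector.
\<close>

lemma braiding_eq_braid:
  assumes R: "is_braiding r q M M R"
  shows "R = braid q (complex_of_real (q powr (- (1 / real (r + 1))))) pos"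
proof (rule intertwiner_unique[OF vector_rep_axioms vector_rep_axioms])
  let ?s = "node r flip 1"
  show "intertwines r (tensor_rep M M) (tensor_rep M M) R" using R by (simp add: is_braiding_def)
  show "intertwines r (tensor_rep M M) (tensor_rep M M)
      (braid q (complex_of_real (q powr (- (1 / real (r + 1))))) pos)"
    by (rule braid_intertwines)
  have s: "?s \<in> {1, r}" by (auto simp: node_def)
  have "R *v vec_tensor (e 1) (e (r + 1)) =
      (q powr weight_form r (fund_weight r ?s) (longest r (fund_weight r ?s))) *\<^sub>R vec_tensor
          (e (r + 1)) (e 1)"
    using R simple_module highest_weight_e lowest_weight_e unfolding is_braiding_def by blast
  then show "R *v vec_tensor (e 1) (e (r + 1)) =
      braid q (complex_of_real (q powr (- (1 / real (r + 1))))) pos *v vec_tensor (e 1) (e (r + 1))"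
    unfolding weight_form_longest_self[OF r_pos s] scaleR_eq_smult ee_def[symmetric]
    using braid_ee[of 1 "r + 1"] r_pos by simp
qed

text \<open>
  The dual vector of $e_1$ has lowest weight, and the coefficient $h^{-1} q^{-1}$ of
  $f^1 \otimes e_1$ in the image of $e_1 \otimes f^1$ is the prescribed
  $q^{-(\omega_s, \omega_s)} = q^{-w}$.
\<close>

lemma braiding_eq_braid_dual:
  assumes R: "is_braiding r q M (dual_rep M) R"
  shows "R = braid_dual q (complex_of_real (q powr (- (1 / real (r + 1))))) pos"
proof (rule intertwiner_unique[OF vector_rep_axioms dual])
  interpret D: vector_rep r q "\<not> flip" "\<lambda>x. r + 2 - pos x"
      "\<lambda>i. - complex_of_real q * c (r + 1 - i)" "dual_rep M"
    by (rule dual)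
  let ?s = "node r flip 1" and ?h = "complex_of_real (q powr (- (1 / real (r + 1))))"
  show "intertwines r (tensor_rep M (dual_rep M)) (tensor_rep (dual_rep M) M) R"
    using R by (simp add: is_braiding_def)
  show "intertwines r (tensor_rep M (dual_rep M)) (tensor_rep (dual_rep M) M) (braid_dual q ?h pos)"
    by (rule braid_dual_intertwines)
  have s: "?s \<in> {1, r}" and s': "node r (\<not> flip) 1 = r + 1 - ?s" using r_pos
      by (auto simp: node_def)
  have De: "D.e (r + 1) = e 1" using dual_e[of 1] by simp
  have "R *v vec_tensor (e 1) (D.e (r + 1)) =
      (q powr weight_form r (fund_weight r ?s) (longest r (fund_weight r (r + 1 - ?s)))) *\<^sub>R
          vec_tensor (D.e (r + 1)) (e 1)"
    using R simple_module highest_weight_e D.simple_module D.lowest_weight_e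
    unfolding is_braiding_def s' by blast
  moreover have "q powr (- w_const r ?s) = inverse (q powr (- (1 / real (r + 1)))) * inverse q"
  proof -
    have "- w_const r ?s = 1 / real (r + 1) + (-1)"
      unfolding w_const_extreme[OF r_pos s] by (simp add: field_simps)
    then have "q powr (- w_const r ?s) = q powr (1 / real (r + 1)) * q powr (-1)"
      by (simp only: powr_add)
    then show ?thesis using q_pos by (simp add: powr_minus)
  qed
  ultimately show "R *v vec_tensor (e 1) (D.e (r + 1)) =
      braid_dual q ?h pos *v vec_tensor (e 1) (D.e (r + 1))"
    unfolding weight_form_longest_dual[OF r_pos s] scaleR_eq_smult De ee_def[symmetric]
    using braid_dual_ee[of 1 1] by (simp add: diag_sum_def)
qed

end

section \<open>Contracting the maps on the legs\<close>

lemma sum_UNIV_pair: "(\<Sum>(a, b)\<in>UNIV. f a b) = (\<Sum>a\<in>UNIV. \<Sum>b\<in>UNIV. f a b)"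
  by (simp add: sum.cartesian_product flip: UNIV_Times_UNIV)

lemma leg_apply_4:
  "leg_apply sc 1 R x [i, j, k, l] = (\<Sum>p\<in>UNIV. sc (R $ (i, j) $ p) (x [fst p, snd p, k, l]))"
  "leg_apply sc 2 R x [i, j, k, l] = (\<Sum>p\<in>UNIV. sc (R $ (j, k) $ p) (x [i, fst p, snd p, l]))"
  by (simp_all add: leg_apply_def case_prod_unfold numeral_2_eq_2)

definition contract12 :: "(complex \<Rightarrow> 'm \<Rightarrow> 'm) \<Rightarrow> ('n::finite \<Rightarrow> complex) \<Rightarrow>
    ('n list \<Rightarrow> 'm::ab_group_add) \<Rightarrow> 'n \<Rightarrow> 'n \<Rightarrow> 'm" where
  "contract12 sc rho x k l = (\<Sum>a\<in>UNIV. sc (rho a) (x [a, a, k, l]))"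

definition contract23 :: "('n::finite list \<Rightarrow> 'm::ab_group_add) \<Rightarrow> 'n \<Rightarrow> 'n \<Rightarrow> 'm" where
  "contract23 x i l = (\<Sum>a\<in>UNIV. x [i, a, a, l])"

text \<open>
  \<open>B\<close> is the braiding of $V$ with itself, \<open>P\<close> its inverse, and \<open>D\<close> the braiding of $V$ with
  $V^*$; \<open>rho\<close> holds the coefficients of $E'$.  The assumption \<open>naturality\<close> is
  $E'_{12} D_{23} = E'_{23} P_{12}$ and \<open>trace\<close> is $E \circ D = \mu E'$, both in matrix entries.
\<close>

locale braid_matrices = vector_space sc
  for sc :: "complex \<Rightarrow> 'm::ab_group_add \<Rightarrow> 'm" +
  fixes B P D :: "complex^('n::finite \<times> 'n)^('n \<times> 'n)" and rho :: "'n \<Rightarrow> complex"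
      and \<mu> h z :: complex
  assumes naturality: "rho x * D $ (x, u) $ (a, b) = rho b * P $ (u, b) $ (x, a)"
    and trace: "(\<Sum>b\<in>UNIV. D $ (b, b) $ (x, a)) = (if x = a then \<mu> * rho a else 0)"
    and P_B: "P ** B = mat 1"
    and hecke: "B $ x' $ y' = h\<^sup>2 * P $ x' $ y' + (if x' = y' then h * z else 0)"
    and D_inv: "D ** matrix_inv D = mat 1"
begin

lemma compose_inverse:
  fixes X :: "'n \<times> 'n \<Rightarrow> 'm" and A C :: "complex^('n \<times> 'n)^('n \<times> 'n)"
  assumes "A ** C = mat 1"
  shows "(\<Sum>p\<in>UNIV. sc (A $ i $ p) (\<Sum>p'\<in>UNIV. sc (C $ p $ p') (X p'))) = X i"
proof -
  have "(\<Sum>p\<in>UNIV. sc (A $ i $ p) (\<Sum>p'\<in>UNIV. sc (C $ p $ p') (X p'))) =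
      (\<Sum>p\<in>UNIV. \<Sum>p'\<in>UNIV. sc (A $ i $ p * C $ p $ p') (X p'))"
    by (simp add: scale_sum_right)
  also have "\<dots> = (\<Sum>p'\<in>UNIV. sc ((A ** C) $ i $ p') (X p'))"
    by (subst sum.swap) (simp add: matrix_matrix_mult_def scale_sum_left)
  also have "\<dots> = (\<Sum>p'\<in>UNIV. if p' = i then X p' else 0)"
    unfolding assms by (rule sum.cong) (auto simp: mat_def)
  finally show ?thesis by simp
qed

lemma contract12_D:
  "contract12 sc rho (leg_apply sc 2 D t) u l =
      (\<Sum>b\<in>UNIV. sc (rho b) (leg_apply sc 1 P t [u, b, b, l]))"
proof -
  have "contract12 sc rho (leg_apply sc 2 D t) u l =
      (\<Sum>x\<in>UNIV. \<Sum>a\<in>UNIV. \<Sum>b\<in>UNIV. sc (rho x * D $ (x, u) $ (a, b)) (t [x, a, b, l]))"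
    unfolding contract12_def leg_apply_4 UNIV_Times_UNIV[symmetric] sum.cartesian_product'
    by (simp add: scale_sum_right)
  also have "\<dots> = (\<Sum>x\<in>UNIV. \<Sum>b\<in>UNIV. \<Sum>a\<in>UNIV. sc (rho b * P $ (u, b) $ (x, a)) (t [x, a, b, l]))"
    unfolding naturality by (rule sum.cong[OF refl], rule sum.swap)
  also have "\<dots> = (\<Sum>b\<in>UNIV. \<Sum>x\<in>UNIV. \<Sum>a\<in>UNIV. sc (rho b * P $ (u, b) $ (x, a)) (t [x, a, b, l]))"
    by (rule sum.swap)
  also have "\<dots> = (\<Sum>b\<in>UNIV. sc (rho b) (leg_apply sc 1 P t [u, b, b, l]))"
    unfolding leg_apply_4 UNIV_Times_UNIV[symmetric] sum.cartesian_product'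
    by (simp add: scale_sum_right)
  finally show ?thesis .
qed

lemma contract23_D:
  "contract23 (leg_apply sc 2 D y) u l = sc \<mu> (\<Sum>a\<in>UNIV. sc (rho a) (y [u, a, a, l]))"
proof -
  have "contract23 (leg_apply sc 2 D y) u l =
      (\<Sum>p\<in>UNIV. sc (\<Sum>b\<in>UNIV. D $ (b, b) $ p) (y [u, fst p, snd p, l]))"
    unfolding contract23_def leg_apply_4 by (subst sum.swap) (simp add: scale_sum_left)
  also have "\<dots> = (\<Sum>x\<in>UNIV. \<Sum>a\<in>UNIV. sc (\<Sum>b\<in>UNIV. D $ (b, b) $ (x, a)) (y [u, x, a, l]))"
    by (simp add: sum.cartesian_product' flip: UNIV_Times_UNIV)
  also have "\<dots> = (\<Sum>x\<in>UNIV. \<Sum>a\<in>UNIV. if x = a then sc (\<mu> * rho a) (y [u, a, a, l]) else 0)"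
    unfolding trace by (intro sum.cong refl) auto
  also have "\<dots> = sc \<mu> (\<Sum>a\<in>UNIV. sc (rho a) (y [u, a, a, l]))"
    by (simp add: scale_sum_right)
  finally show ?thesis .
qed

lemma D_D_inv: "leg_apply sc 2 D (leg_apply sc 2 (matrix_inv D) x) [i, j, k, l] = x [i, j, k, l]"
  unfolding leg_apply_4 prod.collapse
  using compose_inverse[OF D_inv, of "(j, k)" "\<lambda>p. x [i, fst p, snd p, l]"] by simp

lemma P_B_legs: "leg_apply sc 1 P (leg_apply sc 1 B x) [i, j, k, l] = x [i, j, k, l]"
  unfolding leg_apply_4 prod.collapse
  using compose_inverse[OF P_B, of "(i, j)" "\<lambda>p. x [fst p, snd p, k, l]"] by simp

lemma B_legs: "leg_apply sc 1 B x [i, j, k, l] =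
    sc (h\<^sup>2) (leg_apply sc 1 P x [i, j, k, l]) + sc (h * z) (x [i, j, k, l])"
proof -
  have "leg_apply sc 1 B x [i, j, k, l] =
      (\<Sum>p\<in>UNIV. sc (h\<^sup>2) (sc (P $ (i, j) $ p) (x [fst p, snd p, k, l])) +
      (if p = (i, j) then sc (h * z) (x [fst p, snd p, k, l]) else 0))"
    unfolding leg_apply_4 hecke by (rule sum.cong) (auto simp: scale_left_distrib)
  then show ?thesis unfolding leg_apply_4 by (simp add: sum.distrib scale_sum_right)
qed

text \<open>
  $E'_{12} D_{23} B_{12} D_{23}^{-1} = E'_{23} D_{23}^{-1} = \mu^{-1} E_{23}$.
\<close>

lemma contract12_S:
  assumes "\<mu> \<noteq> 0"
  shows "contract12 sc rho (S123 sc B D x) u l = sc (inverse \<mu>) (contract23 x u l)"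
proof -
  let ?y = "leg_apply sc 2 (matrix_inv D) x"
  have "contract12 sc rho (S123 sc B D x) u l = (\<Sum>b\<in>UNIV. sc (rho b) (?y [u, b, b, l]))"
    unfolding S123_def contract12_D P_B_legs ..
  also have "\<dots> = sc (inverse \<mu>) (contract23 (leg_apply sc 2 D ?y) u l)"
    unfolding contract23_D using assms by simp
  also have "contract23 (leg_apply sc 2 D ?y) u l = contract23 x u l"
    unfolding contract23_def D_D_inv ..
  finally show ?thesis .
qed

text \<open>
  $E_{23} D_{23} B_{12} D_{23}^{-1} = \mu E'_{23} B_{12} D_{23}^{-1}$; the Hecke relation replaces
  $B$ by $h^2 P + h z$, and naturality turns $E'_{23} P_{12} D_{23}^{-1}$ into $E'_{12}$.
\<close>

lemma contract23_S:
  "contract23 (S123 sc B D x) u l = sc (\<mu> * h\<^sup>2) (contract12 sc rho x u l) +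
      sc (h * z) (contract23 x u l)"
proof -
  let ?y = "leg_apply sc 2 (matrix_inv D) x"
  have "contract23 (S123 sc B D x) u l =
      sc (\<mu> * h\<^sup>2) (\<Sum>a\<in>UNIV. sc (rho a) (leg_apply sc 1 P ?y [u, a, a, l]))
      + sc (h * z) (sc \<mu> (\<Sum>a\<in>UNIV. sc (rho a) (?y [u, a, a, l])))"
    unfolding S123_def contract23_D B_legs
    by (simp add: scale_right_distrib sum.distrib scale_sum_right mult_ac)
  also have "\<dots> = sc (\<mu> * h\<^sup>2) (contract12 sc rho (leg_apply sc 2 D ?y) u l)
      + sc (h * z) (contract23 (leg_apply sc 2 D ?y) u l)"
    unfolding contract12_D contract23_D ..
  also have "\<dots> = sc (\<mu> * h\<^sup>2) (contract12 sc rho x u l) + sc (h * z) (contract23 x u l)"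
    unfolding contract12_def contract23_def D_D_inv ..
  finally show ?thesis .
qed

end

context vector_rep
begin

definition rho_pow :: "'n \<Rightarrow> complex" where
  "rho_pow a = complex_of_real q ^ (r + 2) / complex_of_real q ^ (2 * pos a)"

lemma sum_over_pos: "(\<Sum>a\<in>UNIV. f (pos a)) = (\<Sum>k=1..r+1. f k)"
  by (rule sum.reindex_bij_betw[OF pos_bij])

text \<open>
  The sum over the basis vectors preceding $a$ is geometric and telescopes, leaving a single power
  of $q$.
\<close>

lemma braid_dual_trace:
  assumes "h \<noteq> 0"
  shows "(\<Sum>b\<in>UNIV. braid_dual q h pos $ (b, b) $ (x, a)) =
    (if x = a then inverse (h * complex_of_real q ^ (r + 1)) * rho_pow a else 0)"
proof -
  define Q where "Q = complex_of_real q"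
  have Q: "Q \<noteq> 0" using q_pos by (simp add: Q_def)
  have pos_eq: "pos a = pos b \<longleftrightarrow> a = b" for a b using inj_pos by (auto dest: injD)
  have ent: "braid_dual q h pos $ (b, b) $ (x, a) = (if x = a then inverse h *
      ((if b = a then inverse Q else 0) - (if pos b < pos a then Q ^ (2 * pos b) * (Q - inverse Q)
          else 0) / Q ^ (2 * pos a)) else 0)" for b
    unfolding braid_dual_def braid_inv_def using Q by (auto simp: Q_def[symmetric])
  have geo: "(\<Sum>j=1..<k. Q ^ (2 * j) * (Q - inverse Q)) = Q ^ (2 * k) * inverse Q - Q"
      if "1 \<le> k" for k
    using that
  proof (induction k rule: dec_induct)
    case base then show ?case using Q by (simp add: power2_eq_square)
  next
    case (step n)
    then have "(\<Sum>j=1..<Suc n. Q ^ (2 * j) * (Q - inverse Q)) =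
        Q ^ (2 * n) * inverse Q - Q + Q ^ (2 * n) * (Q - inverse Q)" by simp
    also have "\<dots> = Q ^ (2 * Suc n) * inverse Q - Q"
      using Q by (simp add: power2_eq_square algebra_simps)
    finally show ?case .
  qed
  have "(\<Sum>b\<in>UNIV. if pos b < pos a then Q ^ (2 * pos b) * (Q - inverse Q) else 0) =
      (\<Sum>k=1..r+1. if k < pos a then Q ^ (2 * k) * (Q - inverse Q) else 0)"
    by (rule sum_over_pos)
  also have "\<dots> = (\<Sum>j\<in>{1..r+1} \<inter> {k. k < pos a}. Q ^ (2 * j) * (Q - inverse Q))"
    by (subst sum.inter_restrict) (simp_all only: mem_Collect_eq finite_atLeastAtMost)
  also have "{1..r+1} \<inter> {k. k < pos a} = {1..<pos a}" using pos_in[of a] by auto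
  also have "(\<Sum>j\<in>\<dots>. Q ^ (2 * j) * (Q - inverse Q)) = Q ^ (2 * pos a) * inverse Q - Q"
    using geo pos_in[of a] by simp
  finally have s: "(\<Sum>b\<in>UNIV. if pos b < pos a then Q ^ (2 * pos b) * (Q - inverse Q) else 0) =
      Q ^ (2 * pos a) * inverse Q - Q" .
  have "(\<Sum>b\<in>UNIV. braid_dual q h pos $ (b, b) $ (x, a)) = (if x = a then inverse h *
     (inverse Q - (\<Sum>b\<in>UNIV. if pos b < pos a then Q ^ (2 * pos b) * (Q - inverse Q)
         else 0) / Q ^ (2 * pos a)) else 0)"
    unfolding ent by (simp add: sum_distrib_left[symmetric] sum_subtractf sum_divide_distrib)
  also have "\<dots> = (if x = a then inverse (h * Q ^ (r + 1)) * (Q ^ (r + 2) / Q ^ (2 * pos a)) else 0)"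
    unfolding s using Q assms by (simp add: field_simps)
  finally show ?thesis by (simp only: rho_pow_def Q_def)
qed

lemma braid_dual_naturality:
  "rho_pow x * braid_dual q h pos $ (x, u) $ (a, b) =
      rho_pow b * braid_inv q h pos $ (u, b) $ (x, a)"
  using q_pos by (simp add: rho_pow_def braid_dual_def)

text \<open>
  The action of the $K_i$ determines the numbers $(\alpha_i, \nu)$, since $q$ is not a root of unity;
  these determine $(\nu, 2\rho)$.  The coefficients $i (r + 1 - i)$ of $2\rho$ are invariant under the
  diagram automorphism, so the outcome is the same for $V(\omega_1)$ and $V(\omega_r)$.
\<close>

lemma weight_two_rho:
  assumes "has_weight r q M nu (axis a 1)"
  shows "weight_form r nu (two_rho r) = real r + 2 - 2 * real (pos a)"
proof -
  define n where "n = node r flip"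
  have D: "weight_form r (simple_root (n i)) nu =
      (if i = pos a then 1 else 0) - (if i + 1 = pos a then 1 else 0)"
    if i: "i \<in> {1..r}" for i
  proof -
    have ni: "n i \<in> {1..r}" using node_in[OF i] by (simp add: n_def)
    have "complex_of_real (q powr weight_form r (simple_root (n i)) nu) *s e (pos a) =
        kval q i (pos a) *s e (pos a)"
      using assms ni K_e[OF i pos_in[of a]]
          by (simp add: has_weight_def n_def axis_eq_e scaleR_eq_smult)
    then have "complex_of_real (q powr weight_form r (simple_root (n i)) nu) = kval q i (pos a)"
      using e_nonzero by simp
    then have "q powr weight_form r (simple_root (n i)) nu =
        q powr ((if pos a = i then 1 else 0) - (if pos a = i + 1 then 1 else 0))"
      unfolding kval_powr[OF q_pos] by (simp only: of_real_eq_iff)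
    then have "weight_form r (simple_root (n i)) nu =
        (if pos a = i then 1 else 0) - (if pos a = i + 1 then 1 else 0)"
      using q_pos q_less powr_inj[of q] by (metis less_irrefl)
    then show ?thesis by auto
  qed
  define f where "f i = real i * (real r + 1 - real i)" for i
  have fn: "f (n i) = f i" if "i \<in> {1..r}" for i
    using that by (auto simp: f_def n_def node_def of_nat_diff)
  have bij: "bij_betw n {1..r} {1..r}"
    by (rule bij_betw_byWitness[where f' = n]) (use node_node node_in in \<open>auto simp: n_def\<close>)
  have "weight_form r nu (two_rho r) = (\<Sum>i=1..r. f i * weight_form r (simple_root i) nu)"
    by (simp add: weight_form_two_rho f_def)
  also have "\<dots> = (\<Sum>i=1..r. f (n i) * weight_form r (simple_root (n i)) nu)"
    by (rule sum.reindex_bij_betw[OF bij, symmetric])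
  also have "\<dots> = (\<Sum>i=1..r. (if i = pos a then f i else 0) - (if i = pos a - 1 then f i else 0))"
    using pos_in[of a] by (intro sum.cong refl) (auto simp: fn D)
  also have "\<dots> = f (pos a) - f (pos a - 1)"
    using pos_in[of a] r_pos by (auto simp: sum_subtractf f_def)
  also have "\<dots> = real r + 2 - 2 * real (pos a)"
    using pos_in[of a] by (simp add: f_def of_nat_diff algebra_simps)
  finally show ?thesis .
qed

end

section \<open>The quantum dimension\<close>

lemma sum_q_powers:
  assumes "0 < q" "q < 1"
  shows "(\<Sum>k=1..r+1. q powr (real r + 2 - 2 * real k)) * (q - inverse q) =
      q powr (real r + 1) - q powr (- (real r + 1))"
proof -
  have "(\<Sum>k=1..n. q powr (t - 2 * real k)) * (q - inverse q) =
      q powr (t - 1) - q powr (t - 1 - 2 * real n)" for t n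
  proof (induction n)
    case (Suc n)
    have "q powr (t - 2 * real (Suc n)) * (q - inverse q) =
        q powr (t - 2 * real (Suc n) + 1) - q powr (t - 2 * real (Suc n) + (-1))"
      using assms by (simp only: powr_add) (simp add: powr_minus algebra_simps)
    also have "t - 2 * real (Suc n) + 1 = t - 1 - 2 * real n" by simp
    also have "t - 2 * real (Suc n) + (-1) = t - 1 - 2 * real (Suc n)" by simp
    finally show ?case using Suc by (simp add: distrib_right[of _ _ "q - inverse q"])
  qed simp
  from this[of "real r + 2" "r + 1"] show ?thesis by (simp add: algebra_simps)
qed

lemma sum_q_powers_inverse:
  "(\<Sum>k=1..r+1. q powr (- (real r + 2 - 2 * real k))) =
      (\<Sum>k=1..r+1. q powr (real r + 2 - 2 * real k))"
  by (rule sum.reindex_bij_witness[of _ "\<lambda>k. r + 2 - k" "\<lambda>k. r + 2 - k"])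
    (auto simp: of_nat_diff algebra_simps)

text \<open>
  Here \<open>d\<close> is $[r+1]_q$, so the identity reads
  $(q^r + q^{-r}) [r+1]_q - 2 = (q^{r+1} + q^{-(r+1)}) [r]_q$.
\<close>

lemma quantum_dimension_identity:
  fixes q :: real
  assumes "0 < q" "q < 1"
    and d: "d * (q - inverse q) = q powr (real r + 1) - q powr (- (real r + 1))"
  shows "(q powr (- real r) * d - 1) + (q powr real r * d - 1) =
    (q powr (real r + 1) + q powr (- (real r + 1))) * q_num q (real r)"
proof -
  define A where "A = q powr real r"
  have A: "A \<noteq> 0" using assms by (simp add: A_def)
  have z: "q - inverse q \<noteq> 0" using q_diff_neg[OF assms(1,2)] by simp
  have p: "q powr (- real r) = inverse A" "q powr (real r + 1) = A * q" "q powr (- (real r + 1)) =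
      inverse A * inverse q"
    unfolding powr_minus powr_add using assms by (simp_all add: A_def)
  have "((inverse A * d - 1) + (A * d - 1)) * (q - inverse q) =
      (inverse A + A) * (d * (q - inverse q)) - 2 * (q - inverse q)"
    by (simp add: algebra_simps)
  also have "\<dots> = (A * q + inverse A * inverse q) * (A - inverse A)"
    unfolding d p using A assms(1) by (simp add: field_simps)
  finally show ?thesis
    unfolding q_num_def p A_def[symmetric] using z by (simp add: field_simps)
qed

section \<open>Evaluating the relations in the algebra\<close>

lemma lin_extend_superset:
  assumes "vector_space sc" "finite A" "Poly_Mapping.keys f \<subseteq> A"
  shows "lin_extend sc \<phi> f = (\<Sum>k\<in>A. sc (Poly_Mapping.lookup f k) (\<phi> k))"
proof -
  interpret vector_space sc by fact
  show ?thesis unfolding lin_extend_def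
    by (rule sum.mono_neutral_left) (use assms in \<open>auto simp: in_keys_iff\<close>)
qed

lemma lookup_pm_scale: "Poly_Mapping.lookup (pm_scale c f) k = c * Poly_Mapping.lookup f k"
  by (simp add: pm_scale_def Poly_Mapping.map.rep_eq when_def)

lemma vector_space_pm_scale: "vector_space pm_scale"
  by unfold_locales (auto intro!: poly_mapping_eqI simp: lookup_pm_scale lookup_add algebra_simps)

lemma lin_extend_linear:
  assumes "vector_space sc"
  shows "lin_extend sc \<phi> (f + g) = lin_extend sc \<phi> f + lin_extend sc \<phi> g"
    and "lin_extend sc \<phi> (pm_scale c f) = sc c (lin_extend sc \<phi> f)"
    and "lin_extend sc \<phi> (Poly_Mapping.single k 1) = \<phi> k"
proof -
  interpret vector_space sc by fact
  let ?A = "Poly_Mapping.keys f \<union> Poly_Mapping.keys g"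
  have "lin_extend sc \<phi> h = (\<Sum>k\<in>?A. sc (Poly_Mapping.lookup h k) (\<phi> k))"
    if "Poly_Mapping.keys h \<subseteq> ?A" for h
    by (rule lin_extend_superset[OF assms _ that]) simp
  from this[of f] this[of g] this[of "f + g"] Poly_Mapping.keys_add[of f g]
  show "lin_extend sc \<phi> (f + g) = lin_extend sc \<phi> f + lin_extend sc \<phi> g"
    by (simp add: lookup_add scale_left_distrib sum.distrib)
  have "lin_extend sc \<phi> (pm_scale c f) =
      (\<Sum>k\<in>Poly_Mapping.keys f. sc (c * Poly_Mapping.lookup f k) (\<phi> k))"
    by (subst lin_extend_superset[OF assms, of "Poly_Mapping.keys f"])
        (auto simp: in_keys_iff lookup_pm_scale)
  then show "lin_extend sc \<phi> (pm_scale c f) = sc c (lin_extend sc \<phi> f)"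
    by (simp add: lin_extend_def scale_sum_right)
  show "lin_extend sc \<phi> (Poly_Mapping.single k 1) = \<phi> k"
    by (simp add: lin_extend_def)
qed

lemma additive_sum:
  fixes f :: "'a::ab_group_add \<Rightarrow> 'b::ab_group_add"
  assumes "\<And>x y. f (x + y) = f x + f y"
  shows "f (sum X A) = (\<Sum>a\<in>A. f (X a))" and "f (x - y) = f x - f y"
proof -
  interpret additive f by unfold_locales (rule assms)
  show "f (sum X A) = (\<Sum>a\<in>A. f (X a))" "f (x - y) = f x - f y" by (rule sum, rule diff)
qed

lemma leg_apply_linear:
  fixes f :: "'a::ab_group_add \<Rightarrow> 'b::ab_group_add"
  assumes "\<And>x y. f (x + y) = f x + f y" "\<And>c x. f (sc c x) = sc' c (f x)"
  shows "f (leg_apply sc n R x ls) = leg_apply sc' n R (\<lambda>ls. f (x ls)) ls"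
  by (simp add: leg_apply_def additive_sum(1)[of f, OF assms(1)] assms(2) case_prod_unfold)

lemma leg_contract_linear:
  fixes f :: "'a::ab_group_add \<Rightarrow> 'b::ab_group_add"
  assumes "\<And>x y. f (x + y) = f x + f y" "\<And>c x. f (sc c x) = sc' c (f x)"
  shows "f (leg_contract sc n \<epsilon> x ls) = leg_contract sc' n \<epsilon> (\<lambda>ls. f (x ls)) ls"
  by (simp add: leg_contract_def additive_sum(1)[of f, OF assms(1)] assms(2) case_prod_unfold)

lemma S123_linear:
  fixes f :: "'a::ab_group_add \<Rightarrow> 'b::ab_group_add"
  assumes "\<And>x y. f (x + y) = f x + f y" "\<And>c x. f (sc c x) = sc' c (f x)"
  shows "f (S123 sc B D x ls) = S123 sc' B D (\<lambda>ls. f (x ls)) ls"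
  by (simp add: S123_def leg_apply_linear[of f sc sc', OF assms])

lemma relations_vanish:
  assumes "presents_algebra sc p Rel" "x \<in> Rel"
  shows "lin_extend sc (\<lambda>u. prod_list (map (\<lambda>(i, j). p i j) (letters u))) x = 0"
proof -
  interpret vector_space pm_scale by (rule vector_space_pm_scale)
  have "1 * x * 1 \<in> {f * x * g | f x g. x \<in> Rel}" using assms(2) by blast
  then have "x \<in> span {f * x * g | f x g. x \<in> Rel}" by (simp add: span_base)
  then show ?thesis using assms(1) unfolding presents_algebra_def Let_def by blast
qed

text \<open>
  The evaluation of the free algebra is linear on the coefficients of tensors and so commutes with
  $S_{123}$ and with contractions; it kills the defining relations.
\<close>

lemma algebra_relations:
  fixes p :: "'n::finite \<Rightarrow> 'n \<Rightarrow> 'b::ring_1"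
  assumes B: "presents_algebra sc p (B_relations r s q wt RVV RVD RDD)"
  shows "length ls = 4 \<Longrightarrow> S123 sc RVV RVD (family_prod (*) p p) ls =
      sc (q_pow q (w_const r s)) (family_prod (*) p p ls)"
    and "leg_contract sc 1 (ev' r q wt) (family p) [] = sc (q_pow q (m_const r s)) 1"
proof -
  let ?ev = "lin_extend sc (\<lambda>u. prod_list (map (\<lambda>(i, j). p i j) (letters u)))"
  have vs: "vector_space sc" using B by (simp add: presents_algebra_def complex_algebra_def)
  note lin = lin_extend_linear[OF vs]
  have diff: "?ev (x - y) = ?ev x - ?ev y" for x y by (rule additive_sum(2)) (rule lin)
  have gen: "?ev (free_gen i j) = p i j" for i j by (simp add: free_gen_def lin)
  have gen2: "?ev (free_gen i j * free_gen k l) = p i j * p k l" for i j k l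
    by (simp add: free_gen_def mult_single lin plus_fword_def)
  have fam2: "?ev (family_prod (*) free_gen free_gen ls) = family_prod (*) p p ls"
    and fam: "?ev (family free_gen ls) = family p ls" for ls
    by (simp_all add: family_prod_def family_def gen gen2)
  have "?ev (Poly_Mapping.single 0 1) = 1" by (simp only: lin) (simp add: zero_fword_def)
  then have one: "?ev 1 = 1" by (simp only: single_one)
  {
    assume "length ls = 4"
    then have "S123 pm_scale RVV RVD (family_prod (*) free_gen free_gen) ls -
        pm_scale (q_pow q (w_const r s)) (family_prod (*) free_gen free_gen ls) \<in> B_relations r s q
            wt RVV RVD RDD"
      unfolding B_relations_def Let_def components_def by blast
    from relations_vanish[OF B this]
    show "S123 sc RVV RVD (family_prod (*) p p) ls =
        sc (q_pow q (w_const r s)) (family_prod (*) p p ls)"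
      by (simp add: diff lin S123_linear[of ?ev pm_scale sc, OF lin(1,2)] fam2)
  }
  have "leg_contract pm_scale 1 (ev' r q wt) (family free_gen) [] -
      pm_scale (q_pow q (m_const r s)) 1
      \<in> B_relations r s q wt RVV RVD RDD"
    unfolding B_relations_def Let_def components_def by force
  from relations_vanish[OF B this]
  show "leg_contract sc 1 (ev' r q wt) (family p) [] = sc (q_pow q (m_const r s)) 1"
    by (simp add: diff lin leg_contract_linear[of ?ev pm_scale sc, OF lin(1,2)] one fam)
qed

section \<open>The quantum metric dimension\<close>

context braid_matrices
begin

definition double_contract :: "('n list \<Rightarrow> 'm) \<Rightarrow> 'm" where
  "double_contract X = (\<Sum>a\<in>UNIV. sc (rho a) (contract23 X a a))"

lemma double_contract_cong: "tensor_eq 4 X Y \<Longrightarrow> double_contract X = double_contract Y"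
  by (simp add: double_contract_def contract23_def tensor_eq_def)

lemma double_contract_diff: "double_contract (\<lambda>ls. X ls - Y ls) =
    double_contract X - double_contract Y"
  by (simp add: double_contract_def contract23_def sum_subtractf scale_right_diff_distrib)

lemma double_contract_scale: "double_contract (\<lambda>ls. sc c (X ls)) = sc c (double_contract X)"
  by (simp add: double_contract_def contract23_def scale_sum_right mult.commute)

lemma double_contract_S: "double_contract (S123 sc B D x) =
    sc (\<mu> * h\<^sup>2) (\<Sum>a\<in>UNIV. sc (rho a) (contract12 sc rho x a a)) + sc (h * z) (double_contract x)"
  unfolding double_contract_def contract23_S
  by (simp add: scale_right_distrib sum.distrib scale_sum_right mult_ac)

end

lemma leg_contract_ev':
  assumes "vector_space sc" "\<And>a. q_pow q (weight_form r (wt a) (two_rho r)) = rho a"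
  shows "leg_contract sc 1 (ev' r q wt) X [] = (\<Sum>a\<in>UNIV. sc (rho a) (X [a, a]))"
proof -
  interpret vector_space sc by fact
  show ?thesis
    unfolding leg_contract_def sum_UNIV_pair ev'_def assms(2)
    by (simp add: if_distrib[of "\<lambda>c. sc c _"] cong: if_cong)
qed

lemma leg_contract_ev:
  assumes "vector_space sc"
  shows "leg_contract sc 2 ev X [i, l] = contract23 X i l"
proof -
  interpret vector_space sc by fact
  show ?thesis
    unfolding leg_contract_def sum_UNIV_pair ev_def contract23_def
    by (simp add: if_distrib[of "\<lambda>c. sc c _"] cong: if_cong)
qed

theorem proposition4p5:
  fixes r s :: nat and q :: real
    and V :: "('n::finite) uq_rep" and wt :: "'n \<Rightarrow> weight"
    and RVV RVD RDD :: "complex^('n \<times> 'n)^('n \<times> 'n)"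
    and sc :: "complex \<Rightarrow> 'b::ring_1 \<Rightarrow> 'b" and p :: "'n \<Rightarrow> 'n \<Rightarrow> 'b"
    and lp :: "'b \<Rightarrow> 'op::ab_group_add \<Rightarrow> 'op" and rp :: "'op \<Rightarrow> 'b \<Rightarrow> 'op"
    and lm :: "'b \<Rightarrow> 'om::ab_group_add \<Rightarrow> 'om" and rm :: "'om \<Rightarrow> 'b \<Rightarrow> 'om"
    and dp :: "'n \<Rightarrow> 'n \<Rightarrow> 'op" and dbp :: "'n \<Rightarrow> 'n \<Rightarrow> 'om"
    and lT :: "'b \<Rightarrow> 't::ab_group_add \<Rightarrow> 't" and rT :: "'t \<Rightarrow> 'b \<Rightarrow> 't"
    and tn :: "'op \<times> 'om \<Rightarrow> 'op \<times> 'om \<Rightarrow> 't"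
    and ip :: "'t \<Rightarrow> 'b"
    and w m a :: real and dP dbP :: "'n \<Rightarrow> 'n \<Rightarrow> 'op \<times> 'om"
    and gpm gmp g :: 't
  defines "w \<equiv> w_const r s" and "m \<equiv> m_const r s" and "a \<equiv> a_const r s"
    and "dP \<equiv> (\<lambda>i j. (dp i j, 0))" and "dbP \<equiv> (\<lambda>i j. (0, dbp i j))"
    and "gpm \<equiv> metric_part r q wt (mod_scale sc lT) tn dP dbP"
    and "gmp \<equiv> metric_part r q wt (mod_scale sc lT) tn dbP dP"
    and "g \<equiv> gpm + gmp"
  assumes "r \<ge> 1" and "s \<in> {1, r}" and "0 < q" and "q < 1"
    \<comment> \<open>\<open>V\<close> is $V(\omega_s)$ in coordinates with respect to a weight basis with weights \<open>wt\<close>\<close>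
    and "CARD('n) = r + 1"
    and "is_simple_module r q V (fund_weight r s)"
    and "is_weight_basis r q V wt"
    and "is_braiding r q V V RVV"
    and "is_braiding r q V (dual_rep V) RVD"
    and "is_braiding r q (dual_rep V) (dual_rep V) RDD"
    \<comment> \<open>the algebra $\mathcal{B}$\<close>
    and "presents_algebra sc p (B_relations r s q wt RVV RVD RDD)"
    \<comment> \<open>the bimodules $\Omega_+$ and $\Omega_-$\<close>
    and "algebra_bimodule sc lp rp"
    and "presents_left_module sc lp dp (Omega_plus_relations r s q wt RVD RDD sc p)"
    and "tensor_eq 4 (family_prod rp dp p)
           (\<lambda>ls. mod_scale sc lp (q_pow q a)
              (T1234 (mod_scale sc lp) RVV RVD RDD (family_prod lp p dp) ls))"
    and "algebra_bimodule sc lm rm"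
    and "presents_left_module sc lm dbp (Omega_minus_relations r s q wt RVV RVD sc p)"
    and "tensor_eq 4 (family_prod rm dbp p)
           (\<lambda>ls. mod_scale sc lm (q_pow q (- a))
              (T1234 (mod_scale sc lm) RVV RVD RDD (family_prod lm p dbp) ls))"
    \<comment> \<open>$\Omega\otimes_{\mathcal{B}}\Omega$ for $\Omega=\Omega_+\oplus\Omega_-$\<close>
    and "is_tensor_product sc (lact_sum lp lm) (ract_sum rp rm) (lact_sum lp lm) (ract_sum rp rm)
           lT rT tn"
    \<comment> \<open>the inverse metric\<close>
    and "bimodule_map_to_algebra lT rT ip"
    and "tensor_eq 4 (family_prod (\<lambda>x y. ip (tn x y)) dP dP) (\<lambda>ls. 0)"
    and "tensor_eq 4 (family_prod (\<lambda>x y. ip (tn x y)) dbP dbP) (\<lambda>ls. 0)"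
    and "tensor_eq 4 (family_prod (\<lambda>x y. ip (tn x y)) dP dbP)
           (\<lambda>ls. sc (q_pow q a * q_pow q (- w - m))
                    (S123 sc RVV RVD (leg_insert sc 3 coev (family p)) ls)
                 - sc (q_pow q a * q_pow q (- m)) (family_prod (*) p p ls))"
    and "tensor_eq 4 (family_prod (\<lambda>x y. ip (tn x y)) dbP dP)
           (\<lambda>ls. leg_insert sc 2 (coev' r q wt) (family p) ls
                 - sc (q_pow q (- m)) (family_prod (*) p p ls))"
  shows "ip gpm = sc (complex_of_real (q powr (- m) * qdim r q wt - 1)) 1
    \<and> ip gmp = sc (complex_of_real (q powr m * qdim r q wt - 1)) 1
    \<and> ip g = sc (complex_of_real
           ((q powr (real r + 1) + q powr (- (real r + 1))) * q_num q (real r))) 1"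
proof -
  note r = \<open>r \<ge> 1\<close> and s = \<open>s \<in> {1, r}\<close> and q = \<open>0 < q\<close> \<open>q < 1\<close>
  note pres = \<open>presents_algebra sc p (B_relations r s q wt RVV RVD RDD)\<close>
  note wb = \<open>is_weight_basis r q V wt\<close>
  note ip = \<open>bimodule_map_to_algebra lT rT ip\<close>
  have alg: "complex_algebra sc" using pres by (simp add: presents_algebra_def)
  then have vs: "vector_space sc" and sc_mult: "sc c (x * y) = sc c x * y" for c x y
    by (simp_all add: complex_algebra_def)
  obtain v0 where "highest_weight_vector r q V (fund_weight r s) v0" "is_uq_module r q V"
    using \<open>is_simple_module r q V (fund_weight r s)\<close> by (auto simp: is_simple_module_def)
  then obtain pos c where V: "vector_rep r q (s \<noteq> 1) pos c V"
    using simple_module_is_vector_rep[OF r s q \<open>CARD('n) = r + 1\<close> _ _ wb] by metis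
  interpret V: vector_rep r q "s \<noteq> 1" pos c V by (rule V)
  define h where "h = complex_of_real (q powr (- (1 / real (r + 1))))"
  define Q where "Q = complex_of_real q"
  define z where "z = Q - inverse Q"
  define \<mu> where "\<mu> = inverse (h * Q ^ (r + 1))"
  have h: "h \<noteq> 0" and Q: "Q \<noteq> 0" using q by (simp_all add: h_def Q_def)
  have \<mu>: "\<mu> \<noteq> 0" using h Q by (simp add: \<mu>_def)
  have RVV: "RVV = braid q h pos" unfolding h_def
    by (rule V.braiding_eq_braid) fact
  have RVD: "RVD = braid_dual q h pos" unfolding h_def
    by (rule V.braiding_eq_braid_dual) fact
  have "invertible RVD" using \<open>is_braiding r q V (dual_rep V) RVD\<close> by (simp add: is_braiding_def)
  then have D_inv: "RVD ** matrix_inv RVD = mat 1"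
    unfolding invertible_def matrix_inv_def by (rule someI2_ex) blast
  interpret braid_matrices sc RVV "braid_inv q h pos" RVD V.rho_pow \<mu> h z
  proof (intro braid_matrices.intro[OF vs] braid_matrices_axioms.intro D_inv)
    show "V.rho_pow x * RVD $ (x, u) $ (a, b) =
        V.rho_pow b * braid_inv q h pos $ (u, b) $ (x, a)" for x u a b
      unfolding RVD by (rule V.braid_dual_naturality)
    show "(\<Sum>b\<in>UNIV. RVD $ (b, b) $ (x, a)) = (if x = a then \<mu> * V.rho_pow a else 0)" for x a
      unfolding RVD \<mu>_def Q_def by (rule V.braid_dual_trace[OF h])
    show "braid_inv q h pos ** RVV = mat 1" unfolding RVV by (rule V.braid_inv_braid[OF h])
    show "RVV $ x' $ y' = h\<^sup>2 * braid_inv q h pos $ x' $ y' + (if x' = y' then h * z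
        else 0)" for x' y'
      unfolding RVV z_def Q_def by (rule braid_hecke[OF h V.inj_pos])
  qed

  have weight: "weight_form r (wt a) (two_rho r) = real r + 2 - 2 * real (pos a)" for a
    using wb by (intro V.weight_two_rho) (simp add: is_weight_basis_def)
  have rho: "q_pow q (weight_form r (wt a) (two_rho r)) = V.rho_pow a" for a
  proof -
    have "q powr (real r + 2 - 2 * real (pos a)) = q powr real (r + 2) / q powr real (2 * pos a)"
      by (simp add: powr_diff[symmetric] add.commute)
    then show ?thesis unfolding weight q_pow_def V.rho_pow_def using q
        by (simp only: powr_realpow) simp
  qed
  have qdim: "(\<Sum>a\<in>UNIV. V.rho_pow a) = complex_of_real (qdim r q wt)"
    unfolding qdim_def rho[symmetric] q_pow_def by simp
  have qdim_sum: "qdim r q wt = (\<Sum>k=1..r+1. q powr (real r + 2 - 2 * real k))"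
    unfolding qdim_def weight by (rule V.sum_over_pos)
  have "(\<Sum>a\<in>UNIV. q powr (- weight_form r (wt a) (two_rho r))) = qdim r q wt"
    unfolding weight qdim_sum sum_q_powers_inverse[symmetric] by (rule V.sum_over_pos)
  then have qdim': "(\<Sum>a\<in>UNIV. q_pow q (- weight_form r (wt a) (two_rho r))) =
      complex_of_real (qdim r q wt)"
    unfolding q_pow_def by (metis of_real_sum)

  have m: "m = real r" unfolding m_def by (rule m_const_extreme[OF r s])
  have w: "w = 1 + - (1 / real (r + 1))" unfolding w_def w_const_extreme[OF r s]
      by (simp add: field_simps)
  have a: "a = 2" unfolding a_def a_const_def
    using simple_root_simple_root[of s r s] s r by auto
  have qm: "q_pow q m = Q ^ r" unfolding m q_pow_def Q_def using q by (simp add: powr_realpow)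
  have q_neg: "q_pow q (- t) = inverse (q_pow q t)" for t by (simp add: q_pow_def powr_minus)
  have q_add: "q_pow q (t + t') = q_pow q t * q_pow q t'" for t t' by (simp add: q_pow_def powr_add)
  have qw: "q_pow q w = Q * h" unfolding w q_add using q by (simp add: q_pow_def h_def Q_def)
  have qa: "q_pow q a = Q\<^sup>2" unfolding a q_pow_def Q_def using q
      by (simp add: powr_realpow[of q 2, simplified])
  (* The constant mu of the braidings is the factor in the definition of the inverse metric. *)
  have qwm: "q_pow q (- w - m) = \<mu>"
  proof -
    have "q_pow q (- w - m) = inverse (q_pow q (w + m))" by (simp add: q_neg[symmetric])
    then show ?thesis unfolding q_add qw qm \<mu>_def by (simp add: mult_ac)
  qed

  have trace_p: "(\<Sum>a\<in>UNIV. sc (V.rho_pow a) (p a a)) = sc (Q ^ r) 1"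
    using algebra_relations(2)[OF pres] unfolding leg_contract_ev'[OF vs rho] m_def[symmetric] qm
    by (simp add: family_def)
  let ?pp = "family_prod (*) p p"
  have pp12: "contract12 sc V.rho_pow ?pp u l = sc (Q ^ r) (p u l)" for u l
  proof -
    have "contract12 sc V.rho_pow ?pp u l = (\<Sum>a\<in>UNIV. sc (V.rho_pow a) (p a a)) * p u l"
      by (simp add: contract12_def family_prod_def sc_mult sum_distrib_right)
    then show ?thesis unfolding trace_p by (simp flip: sc_mult)
  qed
  (* Comparing E'_12 S pp = E_23 pp / mu with the relation S pp = q^w pp; the powers of q cancel
     because 1 / mu = q^w q^m. *)
  have pp23: "contract23 ?pp u l = p u l" for u l
  proof -
    have "sc (inverse \<mu>) (contract23 ?pp u l) = contract12 sc V.rho_pow (S123 sc RVV RVD ?pp) u l"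
      by (rule contract12_S[OF \<mu>, symmetric])
    also have "\<dots> = sc (Q * h) (contract12 sc V.rho_pow ?pp u l)"
      unfolding contract12_def using algebra_relations(1)[OF pres]
      by (simp add: w_def[symmetric] qw scale_sum_right mult_ac)
    also have "\<dots> = sc (inverse \<mu>) (p u l)"
      unfolding pp12 by (simp add: \<mu>_def mult_ac)
    finally show ?thesis using \<mu> by simp
  qed
  have dpp: "double_contract ?pp = sc (Q ^ r) 1"
    unfolding double_contract_def pp23 by (rule trace_p)

  have ip_scale: "ip (mod_scale sc lT t x) = sc t (ip x)" for t x
    using ip sc_mult[of t 1 "ip x"] by (simp add: bimodule_map_to_algebra_def mod_scale_def)
  have ip_add: "ip (x + y) = ip x + ip y" for x y
    using ip by (simp add: bimodule_map_to_algebra_def)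
  have ip_metric: "ip (metric_part r q wt (mod_scale sc lT) tn x y) =
      double_contract (family_prod (\<lambda>x y. ip (tn x y)) x y)" for x y
    unfolding metric_part_def leg_contract_linear[of ip "mod_scale sc lT" sc, OF ip_add ip_scale]
      leg_contract_ev'[OF vs rho] leg_contract_ev[OF vs] double_contract_def
    by (simp add: contract23_def family_prod_def)

  let ?C = "leg_insert sc 3 coev (family p)"
  have C12: "contract12 sc V.rho_pow ?C a a = sc (Q ^ r) 1" for a
    unfolding contract12_def using trace_p by (simp add: leg_insert_def family_def coev_def)
  have C23: "contract23 ?C a a = p a a" for a
    by (simp add: contract23_def leg_insert_def family_def coev_def if_distrib[of "\<lambda>c. sc c _"]
        cong: if_cong)
  have "(\<Sum>a\<in>UNIV. sc (V.rho_pow a) (sc (Q ^ r) 1)) = sc (complex_of_real (qdim r q wt) * Q ^ r) 1"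
    by (simp add: qdim[symmetric] sum_distrib_right scale_sum_left)
  then have "double_contract (S123 sc RVV RVD ?C) =
      sc (\<mu> * h\<^sup>2 * (complex_of_real (qdim r q wt) * Q ^ r) + h * z * Q ^ r) 1"
    unfolding double_contract_S C12
    by (simp add: double_contract_def C23 trace_p scale_left_distrib)
  note C = this
  let ?C' = "leg_insert sc 2 (coev' r q wt) (family p)"
  have C'23: "contract23 ?C' a a = sc (complex_of_real (qdim r q wt)) (p a a)" for a
    by (simp add: contract23_def leg_insert_def family_def coev'_def numeral_2_eq_2
        qdim'[symmetric] scale_sum_left)
  have C': "double_contract ?C' = sc (complex_of_real (qdim r q wt) * Q ^ r) 1"
  proof -
    have "double_contract ?C' = sc (complex_of_real (qdim r q wt))
        (\<Sum>a\<in>UNIV. sc (V.rho_pow a) (p a a))"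
      unfolding double_contract_def C'23 by (simp add: scale_sum_right mult.commute)
    then show ?thesis by (simp add: trace_p)
  qed

  have q_m: "complex_of_real (q powr (- m)) = inverse (Q ^ r)"
    using q_neg[of m] unfolding qm by (simp add: q_pow_def)
  have qm': "complex_of_real (q powr m) = Q ^ r"
    using qm by (simp add: q_pow_def)
  have gpm: "ip gpm = sc (complex_of_real (q powr (- m) * qdim r q wt - 1)) 1"
  proof -
    have "ip gpm = sc (Q\<^sup>2 * \<mu>) (double_contract (S123 sc RVV RVD ?C)) -
        sc (Q\<^sup>2 * inverse (Q ^ r)) (double_contract ?pp)"
      unfolding gpm_def ip_metric
      by (subst double_contract_cong[OF \<open>tensor_eq 4 (family_prod (\<lambda>x y. ip (tn x y)) dP dbP) _\<close>])
        (simp only: double_contract_diff double_contract_scale qa qwm q_neg qm)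
    also have "\<dots> = sc (Q\<^sup>2 * \<mu> * (\<mu> * h\<^sup>2 * (complex_of_real (qdim r q wt) * Q ^ r) +
        h * z * Q ^ r) - Q\<^sup>2 * inverse (Q ^ r) * Q ^ r) 1"
      unfolding C dpp by (simp add: scale_left_diff_distrib)
    also have "Q\<^sup>2 * \<mu> * (\<mu> * h\<^sup>2 * (complex_of_real (qdim r q wt) * Q ^ r) + h * z * Q ^ r) -
        Q\<^sup>2 * inverse (Q ^ r) * Q ^ r
        = inverse (Q ^ r) * complex_of_real (qdim r q wt) - 1"
      unfolding \<mu>_def z_def using Q h by (simp add: field_simps power2_eq_square)
    finally show ?thesis by (simp add: q_m)
  qed
  have gmp: "ip gmp = sc (complex_of_real (q powr m * qdim r q wt - 1)) 1"
  proof -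
    have "ip gmp = double_contract ?C' - sc (inverse (Q ^ r)) (double_contract ?pp)"
      unfolding gmp_def ip_metric
      by (subst double_contract_cong[OF \<open>tensor_eq 4 (family_prod (\<lambda>x y. ip (tn x y)) dbP dP) _\<close>])
        (simp only: double_contract_diff double_contract_scale q_neg qm)
    also have "\<dots> = sc (Q ^ r * complex_of_real (qdim r q wt) - 1) 1"
      unfolding C' dpp using Q by (simp add: scale_left_diff_distrib mult.commute)
    finally show ?thesis by (simp add: qm')
  qed
  have "ip g = sc (complex_of_real ((q powr (- m) * qdim r q wt - 1) +
      (q powr m * qdim r q wt - 1))) 1"
    unfolding g_def ip_add gpm gmp of_real_add scale_left_distrib ..
  also have "(q powr (- m) * qdim r q wt - 1) + (q powr m * qdim r q wt - 1) =
      (q powr (real r + 1) + q powr (- (real r + 1))) * q_num q (real r)"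
    unfolding m by (rule quantum_dimension_identity[OF q])
        (unfold qdim_sum, rule sum_q_powers[OF q])
  finally show ?thesis using gpm gmp by blast
qed

end
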